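(* For every positive integer $n$, let $f$ be chosen uniformly at random from $F(n)$. Then the probability of the event "for every $h\in F(n)$, if $\mathcal{A}(h)$ and $\mathcal{A}(f)$ are isomorphic digraphs then $h\sim f$" tends to $1$ as $n\to\infty$.
   Context: $F(n)$ is the set of all functions $f:\{0,1\}^n\to\{0,1\}^n$ (Boolean networks), written $f=(f_1,\dots,f_n)$. For $i\in[n]$, $e_i$ is the configuration with a $1$ exactly in component $i$, and addition of configurations is componentwise modulo $2$. The asynchronous graph $\mathcal{A}(f)$ is the digraph on $\{0,1\}^n$ with an arc from $x$ to $x+e_i$ for every $x$ and every $i\in[n]$ with $f_i(x)\neq x_i$. The synchronous graph $\mathcal{S}(f)$ is the digraph on $\{0,1\}^n$ with an arc from $x$ to $f(x)$ for every $x$. For $f,h\in F(n)$, $f\sim h$ means $\mathcal{S}(f)$ and $\mathcal{S}(h)$ are isomorphic digraphs (equivalently $h=\pi\circ f\circ\pi^{-1}$ for some permutation $\pi$ of $\{0,1\}^n$). *)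

theory Defs
  imports
    "HOL-Probability.Probability"
    "HOL-Library.Z2"
    "Graph_Theory.Digraph_Isomorphism"
begin

text \<open>Type \<^typ>\<open>bit\<close> is the field with two elements, so its addition is addition modulo 2.
  Configurations and networks are extensional functions, so that equality is equality on the
  domain and both sets are finite.\<close>

definition configs :: "nat \<Rightarrow> (nat \<Rightarrow> bit) set" where
  "configs n = {1..n} \<rightarrow>\<^sub>E UNIV"

definition networks :: "nat \<Rightarrow> ((nat \<Rightarrow> bit) \<Rightarrow> (nat \<Rightarrow> bit)) set" where
  "networks n = configs n \<rightarrow>\<^sub>E configs n"

definition unit_config :: "nat \<Rightarrow> nat \<Rightarrow> (nat \<Rightarrow> bit)" where
  "unit_config n i = (\<lambda>j\<in>{1..n}. if j = i then 1 else 0)"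

definition add_config :: "nat \<Rightarrow> (nat \<Rightarrow> bit) \<Rightarrow> (nat \<Rightarrow> bit) \<Rightarrow> (nat \<Rightarrow> bit)" where
  "add_config n x y = (\<lambda>j\<in>{1..n}. x j + y j)"

definition async_graph ::
  "nat \<Rightarrow> ((nat \<Rightarrow> bit) \<Rightarrow> (nat \<Rightarrow> bit)) \<Rightarrow> (nat \<Rightarrow> bit, (nat \<Rightarrow> bit) \<times> (nat \<Rightarrow> bit)) pre_digraph"
where
  "async_graph n f =
    \<lparr>verts = configs n,
     arcs = {(x, add_config n x (unit_config n i)) | x i.
               x \<in> configs n \<and> i \<in> {1..n} \<and> f x i \<noteq> x i},
     tail = fst, head = snd\<rparr>"

definition sync_graph ::
  "nat \<Rightarrow> ((nat \<Rightarrow> bit) \<Rightarrow> (nat \<Rightarrow> bit)) \<Rightarrow> (nat \<Rightarrow> bit, (nat \<Rightarrow> bit) \<times> (nat \<Rightarrow> bit)) pre_digraph"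
where
  "sync_graph n f =
    \<lparr>verts = configs n, arcs = {(x, f x) | x. x \<in> configs n}, tail = fst, head = snd\<rparr>"

definition sync_equiv ::
  "nat \<Rightarrow> ((nat \<Rightarrow> bit) \<Rightarrow> (nat \<Rightarrow> bit)) \<Rightarrow> ((nat \<Rightarrow> bit) \<Rightarrow> (nat \<Rightarrow> bit)) \<Rightarrow> bool" where
  "sync_equiv n f h \<longleftrightarrow> digraph_iso (sync_graph n f) (sync_graph n h)"

lemma finite_configs: "finite (configs n)"
proof -
  have "(UNIV :: bit set) = {0, 1}"
    using bit_not_zero_iff by auto
  then have "finite (UNIV :: bit set)"
    by (metis finite.emptyI finite.insertI)
  then show ?thesis
    unfolding configs_def by (intro finite_PiE) auto
qed

lemma finite_networks: "finite (networks n)"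
  unfolding networks_def by (intro finite_PiE finite_configs)

lemma networks_nonempty: "networks n \<noteq> {}"
  unfolding networks_def configs_def by (auto simp: PiE_eq_empty_iff)

lemma add_config_in_configs: "add_config n x y \<in> configs n"
  by (auto simp: add_config_def configs_def)

lemma wf_async_graph: "wf_digraph (async_graph n f)"
  by unfold_locales (auto simp: async_graph_def add_config_in_configs)

lemma wf_sync_graph: "f \<in> networks n \<Longrightarrow> wf_digraph (sync_graph n f)"
  by unfold_locales (auto simp: sync_graph_def networks_def)

text \<open>On digraphs whose arcs are pairs of vertices, \<^const>\<open>digraph_iso\<close> is the usual notion:
  a bijection of the vertices that carries one arc relation onto the other.\<close>

lemma digraph_iso_pairs:
  assumes "A \<subseteq> V \<times> V" "B \<subseteq> W \<times> W"
  shows "digraph_iso \<lparr>verts = V, arcs = A, tail = fst, head = snd\<rparr>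
                     \<lparr>verts = W, arcs = B, tail = fst, head = snd\<rparr>
    \<longleftrightarrow> (\<exists>p. bij_betw p V W \<and> map_prod p p ` A = B)"
    (is "digraph_iso ?G ?H \<longleftrightarrow> ?R")
proof
  assume "digraph_iso ?G ?H"
  then obtain k where k: "pre_digraph.digraph_isomorphism ?G k" "?H = app_iso k ?G"
    unfolding digraph_iso_def by auto
  from k(2) have e: "W = iso_verts k ` V" "B = iso_arcs k ` A"
    "iso_tail k = fst" "iso_head k = snd"
    by (simp_all add: app_iso_def)
  from k(1) e have "\<forall>a\<in>A. iso_arcs k a = map_prod (iso_verts k) (iso_verts k) a"
    by (auto simp: pre_digraph.digraph_isomorphism_def prod_eq_iff)
  then have "map_prod (iso_verts k) (iso_verts k) ` A = B"
    using e(2) by (metis image_cong)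
  moreover have "bij_betw (iso_verts k) V W"
    using k(1) e(1) by (simp add: pre_digraph.digraph_isomorphism_def bij_betw_def)
  ultimately show ?R by blast
next
  assume ?R
  then obtain p where p: "bij_betw p V W" "map_prod p p ` A = B" by blast
  define k where "k = \<lparr>iso_verts = p, iso_arcs = map_prod p p, iso_head = snd, iso_tail = fst\<rparr>"
  have "wf_digraph ?G" using assms(1) by unfold_locales auto
  moreover have "inj_on p V" using p(1) by (simp add: bij_betw_def)
  moreover from this have "inj_on (map_prod p p) A"
    using map_prod_inj_on[of p V p V] assms(1) inj_on_subset by blast
  ultimately have "pre_digraph.digraph_isomorphism ?G k"
    by (auto simp: pre_digraph.digraph_isomorphism_def k_def)
  moreover have "?H = app_iso k ?G"
    using p by (simp add: app_iso_def k_def bij_betw_def)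
  ultimately show "digraph_iso ?G ?H"
    unfolding digraph_iso_def by blast
qed

end

theory Submission
  imports Defs "HOL-Real_Asymp.Real_Asymp"
begin

text \<open>Every arc \<open>x \<rightarrow> x + e\<^sub>i\<close> is present in the asynchronous graph of \<open>f\<close> independently with
  probability 1/2, so the underlying undirected graph is a random subgraph of the hypercube with edge
  probability 3/4. Asymptotically almost surely the only injections into the hypercube mapping its
  edges to hypercube edges are the hypercube automorphisms; and an automorphism carrying the
  asynchronous graph of \<open>f\<close> to that of \<open>h\<close> conjugates \<open>f\<close> to \<open>h\<close>.

  For rigidity, colour each edge by the direction of its image. Opposite sides of a 4-cycle have the
  same colour. Around any vertex \<open>x\<close> there are so many 4-cycles linking the edges
  \<open>(x + e\<^sub>i, k)\<close> that all but boundedly many of them share one colour; linking the neighbourhoods of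
  adjacent vertices shows that this colour is a function \<open>\<sigma> k\<close> of \<open>k\<close> alone. Individual edges may
  lie in no 4-cycle at all, but each vertex has only boundedly many exceptional edges, and any two
  adjacent vertices \<open>x\<close>, \<open>x + e\<^sub>j\<close> are joined by a path
  \<open>x, x + a, x + a + b, x + a + b + j, x + b + j, x + j\<close> of unexceptional edges. Hence the embedding
  is \<open>\<sigma>\<close> followed by a translation.

  Two events are needed: all degrees are linear in \<open>n\<close> (this uses 1/4 < 1/2, against the
  \<open>2\<^sup>n\<close> vertices), and links exist between any bounded but large set \<open>A\<close> and any set
  \<open>B\<close> of linear size of directions, since the pairs in \<open>A \<times> B\<close> give independent trials.\<close>

section \<open>Flipping coordinates\<close>

definition flip :: "nat \<Rightarrow> (nat \<Rightarrow> bit) \<Rightarrow> (nat \<Rightarrow> bit)" where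
  "flip i x = x(i := x i + 1)"

lemma bit_cases: "(b::bit) = 0 \<or> b = 1"
  by (cases b) auto

lemma bit_add_self [simp]: "(b::bit) + b = 0" "(b::bit) + (b + c) = c"
  using bit_cases[of b] by auto

lemma bit_neq_iff: "(a::bit) \<noteq> b \<longleftrightarrow> a = b + 1"
  using bit_cases[of a] bit_cases[of b] by auto

lemma bit_add_one_neq [simp]: "(b::bit) + 1 \<noteq> b" "b \<noteq> b + 1"
  using bit_cases[of b] by auto

lemma bit_eq_add_swap: "(a::bit) = b + c \<Longrightarrow> b = c + a"
  using bit_cases[of b] bit_cases[of c] by auto

lemma flip_apply: "flip i x j = (if j = i then x i + 1 else x j)"
  by (simp add: flip_def)

lemma flip_same [simp]: "flip i x i = x i + 1"
  and flip_other [simp]: "j \<noteq> i \<Longrightarrow> flip i x j = x j"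
  by (simp_all add: flip_def)

lemma flip_flip [simp]: "flip i (flip i x) = x"
  by (auto simp: flip_def)

lemma flip_commute: "flip i (flip j x) = flip j (flip i x)"
  by (auto simp: flip_def fun_upd_def fun_eq_iff)

lemma flip_neq [simp]: "flip i x \<noteq> x" "x \<noteq> flip i x"
  by (metis flip_same bit_add_one_neq)+

lemma flip_right_cancel [simp]: "flip i x = flip j x \<longleftrightarrow> i = j"
  by (metis flip_same flip_other bit_add_one_neq(1))

text \<open>If \<open>a' \<noteq> a\<close>, the left side keeps coordinate \<open>a\<close> of
  \<open>z\<close>, so \<open>flip b'\<close> has to undo \<open>flip a\<close> and the right side
  falls back to \<open>z\<close>. Applied to a non-degenerate 4-cycle, this makes opposite sides
  parallel.\<close>

lemma flip_flip_eq:
  assumes "flip a' (flip b z) = flip b' (flip a z)" "a \<noteq> b" "flip b' (flip a z) \<noteq> z"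
  shows "a' = a"
proof (rule ccontr)
  assume "a' \<noteq> a"
  with assms(1,2) have "flip b' (flip a z) a = z a"
    by (metis flip_other)
  then have "b' = a"
    by (metis flip_same flip_other bit_add_one_neq(1))
  with assms(3) show False by simp
qed

lemma flip_in_configs [simp]: "i \<in> {1..n} \<Longrightarrow> flip i x \<in> configs n \<longleftrightarrow> x \<in> configs n"
  by (auto simp: configs_def flip_def PiE_def extensional_def)

lemma add_unit_config:
  assumes "x \<in> configs n" "i \<in> {1..n}"
  shows "add_config n x (unit_config n i) = flip i x"
  using assms
  by (auto simp: fun_eq_iff add_config_def unit_config_def flip_def configs_def PiE_def extensional_def)

lemma configs_eqI:
  assumes "x \<in> configs n" "y \<in> configs n" "\<And>i. i \<in> {1..n} \<Longrightarrow> x i = y i"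
  shows "x = y"
  using assms unfolding configs_def by (metis PiE_ext)

text \<open>Connectivity of the hypercube, by induction on the Hamming distance to
  \<open>y\<close>.\<close>

lemma flip_invariant_imp_constant:
  assumes inv: "\<And>x i. x \<in> configs n \<Longrightarrow> i \<in> {1..n} \<Longrightarrow> g (flip i x) = g x"
    and "x \<in> configs n" "y \<in> configs n"
  shows "g x = g y"
  using assms(2,3)
proof (induction "card {i\<in>{1..n}. x i \<noteq> y i}" arbitrary: x)
  case 0
  then have "x = y" by (intro configs_eqI[of x n y]) auto
  then show ?case by simp
next
  case (Suc d)
  then obtain i where i: "i \<in> {1..n}" "x i \<noteq> y i"
    by (metis (mono_tags, lifting) card.empty empty_Collect_eq nat.distinct(1))
  have "{j\<in>{1..n}. flip i x j \<noteq> y j} = {j\<in>{1..n}. x j \<noteq> y j} - {i}"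
    using i by (auto simp: flip_apply bit_neq_iff)
  then have "d = card {j\<in>{1..n}. flip i x j \<noteq> y j}"
    using Suc.hyps(2) i by simp
  with Suc i have "g (flip i x) = g y" by simp
  with inv[of x i] i Suc.prems show ?case by simp
qed

text \<open>A pair \<open>(x, i)\<close> encodes the arc leaving \<open>x\<close> in direction
  \<open>i\<close>. Adjacency forgets the orientation: one of the two arcs of the edge
  suffices.\<close>

definition adj :: "((nat \<Rightarrow> bit) \<times> nat) set \<Rightarrow> (nat \<Rightarrow> bit) \<Rightarrow> nat \<Rightarrow> bool" where
  "adj W x i \<longleftrightarrow> (x, i) \<in> W \<or> (flip i x, i) \<in> W"

lemma adj_flip [simp]: "adj W (flip i x) i = adj W x i"
  by (auto simp: adj_def)

text \<open>By \<open>meet\<close>, a colour class of size at least \<open>t\<close> misses fewer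
  than \<open>s\<close> elements. If all classes are smaller, some union of classes has size between
  \<open>s\<close> and \<open>s + t\<close>; it and its complement are both large but share no
  colour.\<close>

lemma majority_colour:
  fixes col :: "'a \<Rightarrow> 'b"
  assumes "finite I" "s + 2 * t \<le> card I" "0 < s"
    and meet: "\<And>A B. A \<subseteq> I \<Longrightarrow> B \<subseteq> I \<Longrightarrow> A \<inter> B = {} \<Longrightarrow> s \<le> card A \<Longrightarrow> t \<le> card B
              \<Longrightarrow> \<exists>a\<in>A. \<exists>b\<in>B. col a = col b"
  shows "\<exists>\<tau>. card {i\<in>I. col i \<noteq> \<tau>} < s"
proof (cases "\<exists>\<tau>. t \<le> card {i\<in>I. col i = \<tau>}")
  case True
  then obtain \<tau> where \<tau>: "t \<le> card {i\<in>I. col i = \<tau>}" by blast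
  have "card {i\<in>I. col i \<noteq> \<tau>} < s"
  proof (rule ccontr)
    assume "\<not> ?thesis"
    then show False
      using meet[of "{i\<in>I. col i \<noteq> \<tau>}" "{i\<in>I. col i = \<tau>}", OF _ _ _ _ \<tau>] by auto
  qed
  then show ?thesis by blast
next
  case False
  define P where "P F \<longleftrightarrow> finite F \<and> s \<le> card {i\<in>I. col i \<in> F}" for F
  have "P (col ` I)"
  proof -
    have "{i\<in>I. col i \<in> col ` I} = I" by auto
    then show ?thesis using assms by (simp add: P_def)
  qed
  \<comment> \<open>With least cardinality, dropping one colour from \<open>F\<close> leaves fewer
    than \<open>s\<close> elements covered, and that colour accounts for fewer than \<open>t\<close>
    more.\<close>
  then obtain F where F: "P F" and min: "\<And>F'. P F' \<Longrightarrow> card F \<le> card F'"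
    using ex_has_least_nat[of P _ card] by blast
  have "F \<noteq> {}" using F assms by (auto simp: P_def)
  then obtain c where c: "c \<in> F" by blast
  have "\<not> P (F - {c})"
  proof
    assume "P (F - {c})"
    moreover have "card (F - {c}) < card F" using F c by (intro card_Diff1_less) (auto simp: P_def)
    ultimately show False using min[of "F - {c}"] by simp
  qed
  then have "card {i\<in>I. col i \<in> F - {c}} < s"
    using F unfolding P_def by (meson finite_Diff not_le)
  moreover have "{i\<in>I. col i \<in> F} = {i\<in>I. col i \<in> F - {c}} \<union> {i\<in>I. col i = c}" using c by auto
  then have "card {i\<in>I. col i \<in> F} \<le> card {i\<in>I. col i \<in> F - {c}} + card {i\<in>I. col i = c}"
    using card_Un_le[of "{i\<in>I. col i \<in> F - {c}}" "{i\<in>I. col i = c}"] by simp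
  moreover have "card {i\<in>I. col i = c} < t" using False by (simp add: not_le)
  ultimately have "card {i\<in>I. col i \<in> F} \<le> s + t" by linarith
  moreover have "card (I - {i\<in>I. col i \<in> F}) = card I - card {i\<in>I. col i \<in> F}"
    using assms(1) by (intro card_Diff_subset) auto
  ultimately have "t \<le> card (I - {i\<in>I. col i \<in> F})" using assms(2) by linarith
  then obtain a b where "a \<in> {i\<in>I. col i \<in> F}" "b \<in> I - {i\<in>I. col i \<in> F}" "col a = col b"
    using meet[of "{i\<in>I. col i \<in> F}" "I - {i\<in>I. col i \<in> F}"] F unfolding P_def by blast
  then have False by simp
  then show ?thesis ..
qed

section \<open>Rigidity of embeddings into the hypercube\<close>

text \<open>The path \<open>x + a, x + a + b, x + a + b + j, x + b + j\<close>, its translate by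
  \<open>k\<close>, the \<open>k\<close>-edges at its two inner vertices, and the
  \<open>a\<close>-edges at \<open>x + b\<close> and \<open>x + b + k\<close>. One fixed orientation
  of each of these ten edges is demanded, which makes links independent events of constant
  probability.\<close>

definition link_arcs :: "(nat \<Rightarrow> bit) \<Rightarrow> nat \<Rightarrow> nat \<Rightarrow> nat \<Rightarrow> nat \<Rightarrow> ((nat \<Rightarrow> bit) \<times> nat) set" where
  "link_arcs x j k a b =
    {(flip a x, b), (flip a (flip k x), b),
     (flip b x, a), (flip b (flip k x), a), (flip b (flip j x), a), (flip b (flip j (flip k x)), a),
     (flip a (flip b x), k), (flip a (flip b (flip j x)), k),
     (flip a (flip b x), j), (flip a (flip b (flip k x)), j)}"

definition linked :: "nat \<Rightarrow> nat \<Rightarrow> nat \<Rightarrow> ((nat \<Rightarrow> bit) \<times> nat) set \<Rightarrow> bool" where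
  "linked n s t W \<longleftrightarrow> (\<forall>x\<in>configs n. \<forall>j\<in>{1..n}. \<forall>k\<in>{1..n}. \<forall>A\<in>Pow ({1..n} - {j, k}). \<forall>B\<in>Pow ({1..n} - {j, k}).
     j \<noteq> k \<longrightarrow> A \<inter> B = {} \<longrightarrow> s \<le> card A \<longrightarrow> t \<le> card B \<longrightarrow> (\<exists>a\<in>A. \<exists>b\<in>B. link_arcs x j k a b \<subseteq> W))"

definition star :: "nat \<Rightarrow> ((nat \<Rightarrow> bit) \<times> nat) set \<Rightarrow> (nat \<Rightarrow> bit) \<Rightarrow> nat set" where
  "star n W x = {i\<in>{1..n}. adj W x i}"

definition parallel_star :: "nat \<Rightarrow> ((nat \<Rightarrow> bit) \<times> nat) set \<Rightarrow> (nat \<Rightarrow> bit) \<Rightarrow> nat \<Rightarrow> nat set" where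
  "parallel_star n W x k = {i\<in>{1..n} - {k}. adj W (flip i x) k}"

lemma finite_star [simp]: "finite (star n W x)" "finite (parallel_star n W x k)"
  by (simp_all add: star_def parallel_star_def)

lemma card_UN_bounded:
  fixes f :: "'a \<Rightarrow> 'b set"
  assumes "finite A" "card A \<le> s" "\<And>a. a \<in> A \<Longrightarrow> card (f a) \<le> r"
  shows "card (\<Union>a\<in>A. f a) \<le> s * r"
proof -
  have "card (\<Union>a\<in>A. f a) \<le> (\<Sum>a\<in>A. card (f a))" by (rule card_UN_le[OF assms(1)])
  also have "\<dots> \<le> card A * r" using assms(3) sum_bounded_above[of A "\<lambda>a. card (f a)" r] by simp
  also have "\<dots> \<le> s * r" using assms(2) by simp
  finally show ?thesis .
qed

lemma card_Diff_lower:
  assumes "finite E" "card E \<le> e" "e + r \<le> card D"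
  shows "r \<le> card (D - E)"
  using diff_card_le_card_Diff[OF assms(1), of D] assms(2,3) by linarith

text \<open>In the application \<open>s\<close> is constant while \<open>t\<close> and
  \<open>m\<close> are linear in \<open>n\<close>. The last assumption pays for all sets of
  directions discarded below; \<open>s + 2 < n\<close> leaves a direction outside any set of at most
  \<open>s + 1\<close>.\<close>

locale hypercube_embedding =
  fixes n s t m :: nat and W :: "((nat \<Rightarrow> bit) \<times> nat) set" and p :: "(nat \<Rightarrow> bit) \<Rightarrow> (nat \<Rightarrow> bit)"
  assumes inj: "inj_on p (configs n)"
    and hom: "\<And>x i. x \<in> configs n \<Longrightarrow> i \<in> {1..n} \<Longrightarrow> adj W x i \<Longrightarrow> \<exists>a\<in>{1..n}. p (flip i x) = flip a (p x)"
    and linked: "linked n s t W"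
    and card_star: "\<And>x. x \<in> configs n \<Longrightarrow> m \<le> card (star n W x)"
    and card_parallel_star: "\<And>x k. x \<in> configs n \<Longrightarrow> k \<in> {1..n} \<Longrightarrow> m \<le> card (parallel_star n W x k)"
    and s_pos: "0 < s" and s_less: "s + 2 < n"
    and sizes: "3 * (s * s) + 4 * s + 2 * t + 3 \<le> m"
begin

section \<open>Colours of edges and 4-cycles\<close>

definition colour :: "(nat \<Rightarrow> bit) \<Rightarrow> nat \<Rightarrow> nat" where
  "colour x i = (SOME a. a \<in> {1..n} \<and> p (flip i x) = flip a (p x))"

lemma colour:
  assumes "x \<in> configs n" "i \<in> {1..n}" "adj W x i"
  shows "colour x i \<in> {1..n}" "p (flip i x) = flip (colour x i) (p x)"
proof -
  have "\<exists>a. a \<in> {1..n} \<and> p (flip i x) = flip a (p x)" using hom[OF assms] by blast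
  from someI_ex[OF this] show "colour x i \<in> {1..n}" "p (flip i x) = flip (colour x i) (p x)"
    by (simp_all add: colour_def)
qed

lemma colour_flip:
  assumes "x \<in> configs n" "i \<in> {1..n}" "adj W x i"
  shows "colour (flip i x) i = colour x i"
proof -
  have "p x = flip (colour (flip i x) i) (p (flip i x))"
    using colour(2)[of "flip i x" i] assms by simp
  also have "p (flip i x) = flip (colour x i) (p x)" using colour(2) assms by simp
  finally show ?thesis by (metis flip_flip flip_right_cancel)
qed

lemma colour_inj:
  assumes "x \<in> configs n" "i \<in> {1..n}" "j \<in> {1..n}" "i \<noteq> j" "adj W x i" "adj W x j"
  shows "colour x i \<noteq> colour x j"
proof
  assume "colour x i = colour x j"
  then have "p (flip i x) = p (flip j x)" using colour(2)[of x i] colour(2)[of x j] assms by simp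
  then have "flip i x = flip j x" using inj assms by (simp add: inj_on_eq_iff)
  with assms show False by simp
qed

text \<open>Compare the images of the two paths from \<open>x\<close> to the opposite corner.
  Injectivity of \<open>p\<close> keeps the image from folding back onto \<open>p x\<close>, so
  \<open>flip_flip_eq\<close> applies.\<close>

lemma colour_square:
  assumes x: "x \<in> configs n" and ij: "i \<in> {1..n}" "j \<in> {1..n}" "i \<noteq> j"
    and "adj W x i" "adj W x j" "adj W (flip j x) i" "adj W (flip i x) j"
  shows "colour (flip j x) i = colour x i"
proof (rule flip_flip_eq)
  have 1: "p (flip i (flip j x)) = flip (colour (flip j x) i) (flip (colour x j) (p x))"
    using colour(2)[of "flip j x" i] colour(2)[of x j] assms by simp
  have 2: "p (flip i (flip j x)) = flip (colour (flip i x) j) (flip (colour x i) (p x))"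
    using colour(2)[of "flip i x" j] colour(2)[of x i] assms by (simp add: flip_commute[of i j])
  from 1 2 show "flip (colour (flip j x) i) (flip (colour x j) (p x)) = flip (colour (flip i x) j) (flip (colour x i) (p x))"
    by simp
  show "colour x i \<noteq> colour x j" using colour_inj assms by blast
  have "flip i (flip j x) \<noteq> x" by (metis flip_flip flip_right_cancel ij(3))
  then have "p (flip i (flip j x)) \<noteq> p x" using inj x ij by (simp add: inj_on_eq_iff)
  with 2 show "flip (colour (flip i x) j) (flip (colour x i) (p x)) \<noteq> p x" by simp
qed

section \<open>Links and the majority colour near a vertex\<close>

lemma obtain_link:
  assumes x: "x \<in> configs n" and jk: "j \<in> {1..n}" "k \<in> {1..n}" "j \<noteq> k"
    and AB: "A \<subseteq> {1..n} - {j, k}" "B \<subseteq> {1..n} - {j, k}" "A \<inter> B = {}" "s \<le> card A" "t \<le> card B"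
  obtains a b where "a \<in> A" "b \<in> B" "a \<noteq> b"
    "adj W (flip a x) b" "adj W (flip a (flip k x)) b"
    "adj W (flip b x) a" "adj W (flip b (flip k x)) a" "adj W (flip b (flip j x)) a" "adj W (flip b (flip j (flip k x))) a"
    "adj W (flip a (flip b x)) k" "adj W (flip a (flip b (flip j x))) k"
    "adj W (flip a (flip b x)) j" "adj W (flip a (flip b (flip k x))) j"
proof -
  have "\<exists>a\<in>A. \<exists>b\<in>B. link_arcs x j k a b \<subseteq> W"
    using linked[unfolded linked_def, rule_format, OF x jk(1,2) _ _ jk(3) AB(3,4,5)] AB(1,2) by simp
  then obtain a b where ab: "a \<in> A" "b \<in> B" "link_arcs x j k a b \<subseteq> W" by blast
  moreover have "a \<noteq> b" using ab AB(3) by auto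
  ultimately show thesis using that[of a b] by (simp add: link_arcs_def adj_def)
qed

lemma obtain_other:
  assumes "finite A" "card A \<le> s + 1"
  obtains k where "k \<in> {1..n}" "k \<notin> A"
proof -
  have "\<not> {1..n} \<subseteq> A"
    using card_mono[of A "{1..n}"] assms s_less by auto
  then show thesis using that by blast
qed

text \<open>For a linked pair \<open>a\<close>, \<open>b\<close>, the \<open>k\<close>-edges at
  \<open>x + a\<close> and at \<open>x + b\<close> each form a 4-cycle with the
  \<open>k\<close>-edge at \<open>x + a + b\<close>, so they have the same colour and
  \<open>majority_colour\<close> applies.\<close>

lemma ex_tau:
  assumes x: "x \<in> configs n" and k: "k \<in> {1..n}"
  shows "\<exists>\<tau>. card {i\<in>parallel_star n W x k. colour (flip i x) k \<noteq> \<tau>} \<le> s"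
proof -
  obtain j where j: "j \<in> {1..n}" "j \<noteq> k" using obtain_other[of "{k}"] by auto
  \<comment> \<open>Links come with two directions, so a second one \<open>j\<close> is fixed and
    removed from the indices; this turns \<open>< s\<close> into \<open>\<le> s\<close> at the
    end.\<close>
  let ?I = "parallel_star n W x k - {j}"
  have "s + 2 * t \<le> card ?I"
    using sizes card_parallel_star[OF x k] by (intro card_Diff_lower[of _ 1]) auto
  then have "\<exists>\<tau>. card {i\<in>?I. colour (flip i x) k \<noteq> \<tau>} < s"
  proof (rule majority_colour[rotated])
    fix A B assume AB: "A \<subseteq> ?I" "B \<subseteq> ?I" "A \<inter> B = {}" "s \<le> card A" "t \<le> card B"
    then have "A \<subseteq> {1..n} - {j, k}" "B \<subseteq> {1..n} - {j, k}" by (auto simp: parallel_star_def)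
    with AB obtain a b where ab: "a \<in> A" "b \<in> B" "a \<noteq> b" "adj W (flip a x) b" "adj W (flip b x) a"
      "adj W (flip a (flip k x)) b" "adj W (flip b (flip k x)) a" "adj W (flip a (flip b x)) k"
      using obtain_link[OF x j(1) k j(2), of A B] by metis
    then have ab': "a \<in> {1..n}" "b \<in> {1..n}" "a \<noteq> k" "b \<noteq> k" "adj W (flip a x) k" "adj W (flip b x) k"
      using AB by (auto simp: parallel_star_def)
    have "colour (flip b (flip a x)) k = colour (flip a x) k"
      using ab ab' x k by (intro colour_square) (auto simp: flip_commute)
    moreover have "colour (flip a (flip b x)) k = colour (flip b x) k"
      using ab ab' x k by (intro colour_square) (auto simp: flip_commute)
    ultimately show "\<exists>a\<in>A. \<exists>b\<in>B. colour (flip a x) k = colour (flip b x) k"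
      using ab by (metis flip_commute)
  qed (use s_pos in auto)
  then obtain \<tau> where \<tau>: "card {i\<in>?I. colour (flip i x) k \<noteq> \<tau>} < s" by blast
  have "{i\<in>parallel_star n W x k. colour (flip i x) k \<noteq> \<tau>} \<subseteq> insert j {i\<in>?I. colour (flip i x) k \<noteq> \<tau>}"
    by blast
  then have "card {i\<in>parallel_star n W x k. colour (flip i x) k \<noteq> \<tau>} \<le> card (insert j {i\<in>?I. colour (flip i x) k \<noteq> \<tau>})"
    by (intro card_mono) auto
  also have "\<dots> \<le> s" using \<tau> by simp
  finally show ?thesis by blast
qed

definition tau :: "(nat \<Rightarrow> bit) \<Rightarrow> nat \<Rightarrow> nat" where
  "tau x k = (SOME \<tau>. card {i\<in>parallel_star n W x k. colour (flip i x) k \<noteq> \<tau>} \<le> s)"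

definition exceptions :: "(nat \<Rightarrow> bit) \<Rightarrow> nat \<Rightarrow> nat set" where
  "exceptions x k = {i\<in>parallel_star n W x k. colour (flip i x) k \<noteq> tau x k}"

lemma finite_exceptions [simp]: "finite (exceptions x k)"
  by (simp add: exceptions_def)

lemma card_exceptions: "x \<in> configs n \<Longrightarrow> k \<in> {1..n} \<Longrightarrow> card (exceptions x k) \<le> s"
  unfolding exceptions_def tau_def by (rule someI_ex[OF ex_tau])

lemma regularD:
  assumes "i \<in> parallel_star n W x k - exceptions x k"
  shows "i \<in> {1..n}" "i \<noteq> k" "adj W (flip i x) k" "colour (flip i x) k = tau x k"
  using assms by (auto simp: exceptions_def parallel_star_def)

text \<open>The \<open>k\<close>-edge at \<open>x + i\<close> is also the \<open>k\<close>-edge at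
  \<open>x + k + i\<close>. At most \<open>2 * s\<close> indices are exceptional for
  \<open>x\<close> or \<open>x + k\<close>, so some \<open>i\<close> is regular for both.\<close>

lemma tau_flip_same:
  assumes x: "x \<in> configs n" and k: "k \<in> {1..n}"
  shows "tau (flip k x) k = tau x k"
proof -
  have "card (exceptions x k \<union> exceptions (flip k x) k) \<le> 2 * s"
    using card_Un_le[of "exceptions x k" "exceptions (flip k x) k"]
      card_exceptions[of x k] card_exceptions[of "flip k x" k] x k by simp
  then have "1 \<le> card (parallel_star n W x k - (exceptions x k \<union> exceptions (flip k x) k))"
    using sizes card_parallel_star[OF x k] by (intro card_Diff_lower[of _ "2 * s"]) auto
  then have "parallel_star n W x k - (exceptions x k \<union> exceptions (flip k x) k) \<noteq> {}"
    by force
  then obtain i where i: "i \<in> parallel_star n W x k - exceptions x k" "i \<notin> exceptions (flip k x) k"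
    by blast
  note r = regularD[OF i(1)]
  have "i \<in> parallel_star n W (flip k x) k"
    using r by (simp add: parallel_star_def flip_commute[of i k])
  with i(2) have "tau (flip k x) k = colour (flip i (flip k x)) k"
    by (simp add: exceptions_def)
  also have "\<dots> = colour (flip i x) k"
    using colour_flip[of "flip i x" k] r x k by (simp add: flip_commute[of i k])
  also have "\<dots> = tau x k" using r by simp
  finally show ?thesis .
qed

text \<open>Prepares the two sets for \<open>obtain_link\<close>. \<open>A\<close> is first cut down
  to exactly \<open>s\<close> elements, which bounds the set \<open>E A\<close> of directions spoilt
  by it; \<open>B\<close> then avoids \<open>E A\<close>.\<close>

lemma obtain_rectangle:
  assumes "s + 2 \<le> card C" "2 * s + 2 + r + t \<le> card D" "j \<in> {1..n}" "C \<subseteq> {1..n}" "D \<subseteq> {1..n}"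
    and "\<And>A. A \<subseteq> C \<Longrightarrow> card A = s \<Longrightarrow> finite (E A) \<and> card (E A) \<le> r"
  obtains A B where "A \<subseteq> C - {j, k}" "B \<subseteq> D - {j, k} - E A" "A \<inter> B = {}" "card A = s" "t \<le> card B"
proof -
  have jk: "card {j, k} \<le> 2" by (simp add: card_insert_if)
  have "s \<le> card (C - {j, k})" using assms(1) jk by (intro card_Diff_lower[of _ 2]) auto
  then obtain A where A: "A \<subseteq> C - {j, k}" "card A = s"
    by (metis obtain_subset_with_card_n)
  have E: "finite (E A)" "card (E A) \<le> r" using assms(6)[of A] A by auto
  have "finite A" using A(1) assms(4) by (meson finite_Diff finite_atLeastAtMost finite_subset)
  have "card (({j, k} \<union> A) \<union> E A) \<le> 2 + s + r"
    using card_Un_le[of "{j, k} \<union> A" "E A"] card_Un_le[of "{j, k}" A] jk A(2) E(2) by linarith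
  then have "t \<le> card (D - (({j, k} \<union> A) \<union> E A))"
    using assms(2) \<open>finite A\<close> E(1) by (intro card_Diff_lower[of _ "2 + s + r"]) auto
  then show thesis using that[of A "D - (({j, k} \<union> A) \<union> E A)"] A by blast
qed

text \<open>Three 4-cycles of a link carry the colour along the \<open>k\<close>-edges at
  \<open>x + a\<close>, \<open>x + a + b\<close>, \<open>x + a + b + j\<close>,
  \<open>x + b + j\<close>. The first has the majority colour at \<open>x\<close>, the last that at
  \<open>x + j\<close>.\<close>

lemma tau_flip_other:
  assumes x: "x \<in> configs n" and k: "k \<in> {1..n}" and j: "j \<in> {1..n}" "j \<noteq> k"
  shows "tau (flip j x) k = tau x k"
proof -
  let ?C = "parallel_star n W x k - exceptions x k"
  let ?D = "parallel_star n W (flip j x) k - exceptions (flip j x) k"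
  have C: "s + 2 \<le> card ?C"
    using sizes card_parallel_star[OF x k] card_exceptions[OF x k] by (intro card_Diff_lower[of _ s]) auto
  have D: "2 * s + 2 + 0 + t \<le> card ?D"
    using sizes card_parallel_star[of "flip j x" k] card_exceptions[of "flip j x" k] x j k
    by (intro card_Diff_lower[of _ s]) auto
  have CD: "?C \<subseteq> {1..n}" "?D \<subseteq> {1..n}" by (auto simp: parallel_star_def)
  obtain A B where AB: "A \<subseteq> ?C - {j, k}" "B \<subseteq> ?D - {j, k} - {}" "A \<inter> B = {}" "card A = s" "t \<le> card B"
    using obtain_rectangle[of ?C 0 ?D j "\<lambda>_. {}" k, OF C D j(1) CD] by (metis card.empty finite.emptyI le_refl)
  then have "A \<subseteq> {1..n} - {j, k}" "B \<subseteq> {1..n} - {j, k}" using CD by blast+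
  then obtain a b where ab: "a \<in> A" "b \<in> B" "a \<noteq> b"
    "adj W (flip a x) b" "adj W (flip a (flip k x)) b"
    "adj W (flip b (flip j x)) a" "adj W (flip b (flip j (flip k x))) a"
    "adj W (flip a (flip b x)) k" "adj W (flip a (flip b (flip j x))) k"
    "adj W (flip a (flip b x)) j" "adj W (flip a (flip b (flip k x))) j"
    using obtain_link[OF x j(1) k j(2), of A B] AB by (metis order_refl)
  have a: "a \<in> ?C" "a \<noteq> j" and b: "b \<in> ?D" "b \<noteq> j" using ab AB by blast+
  note ra = regularD[OF a(1)] and rb = regularD[OF b(1)]
  have "tau x k = colour (flip a x) k" using ra by simp
  also have "\<dots> = colour (flip b (flip a x)) k"
    using ab a b ra rb x k j by (intro colour_square[symmetric]) (auto simp: flip_commute)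
  also have "\<dots> = colour (flip j (flip b (flip a x))) k"
    using ab a b ra rb x k j by (intro colour_square[symmetric]) (auto simp: flip_commute)
  also have "\<dots> = colour (flip a (flip b (flip j x))) k"
    by (simp add: flip_commute)
  also have "\<dots> = colour (flip b (flip j x)) k"
    using ab a b ra rb x k j by (intro colour_square) (auto simp: flip_commute)
  also have "\<dots> = tau (flip j x) k" using rb by simp
  finally show ?thesis by simp
qed

section \<open>The global map of directions\<close>

definition sigma :: "nat \<Rightarrow> nat" where
  "sigma = tau (\<lambda>i\<in>{1..n}. 0)"

text \<open>\<open>tau\<close> is constant along every edge of the full hypercube, present in
  \<open>W\<close> or not, so any base point in \<open>sigma\<close> gives the same map.\<close>

lemma tau_eq_sigma:
  assumes "x \<in> configs n" "k \<in> {1..n}"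
  shows "tau x k = sigma k"
  unfolding sigma_def
proof (rule flip_invariant_imp_constant[where g = "\<lambda>x. tau x k"])
  fix x i assume "x \<in> configs n" "i \<in> {1..n}"
  then show "tau (flip i x) k = tau x k"
    using tau_flip_same tau_flip_other assms(2) by (cases "i = k") auto
qed (use assms in \<open>auto simp: configs_def\<close>)

lemma card_regular: "x \<in> configs n \<Longrightarrow> k \<in> {1..n} \<Longrightarrow> m - s \<le> card (parallel_star n W x k - exceptions x k)"
  using sizes card_parallel_star[of x k] card_exceptions[of x k] by (intro card_Diff_lower[of _ s]) auto

lemma sigma_in:
  assumes k: "k \<in> {1..n}"
  shows "sigma k \<in> {1..n}"
proof -
  define x :: "nat \<Rightarrow> bit" where "x = (\<lambda>i\<in>{1..n}. 0)"
  have x: "x \<in> configs n" by (simp add: x_def configs_def)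
  have "0 < card (parallel_star n W x k - exceptions x k)"
    using card_regular[OF x k] sizes s_pos by linarith
  then obtain i where "i \<in> parallel_star n W x k - exceptions x k"
    by (metis card_gt_0_iff ex_in_conv)
  note r = regularD[OF this]
  then show ?thesis
    using colour(1)[of "flip i x" k] tau_eq_sigma[OF x k] x k by simp
qed

text \<open>At a suitable vertex \<open>x + a + b\<close>, the \<open>k\<close>-edge inherits colour
  \<open>sigma k\<close> from the one at \<open>x + a\<close>, and the \<open>j\<close>-edge
  inherits \<open>sigma j\<close> from the one at \<open>x + b\<close>. Two edges at one vertex have
  different colours.\<close>

lemma sigma_inj: "inj_on sigma {1..n}"
proof (rule inj_onI, rule ccontr)
  fix j k assume j: "j \<in> {1..n}" and k: "k \<in> {1..n}" and eq: "sigma j = sigma k" and jk: "j \<noteq> k"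
  define x :: "nat \<Rightarrow> bit" where "x = (\<lambda>i\<in>{1..n}. 0)"
  have x: "x \<in> configs n" by (simp add: x_def configs_def)
  let ?C = "parallel_star n W x k - exceptions x k"
  let ?D = "parallel_star n W x j - exceptions x j"
  have C: "s + 2 \<le> card ?C" and D: "2 * s + 2 + 0 + t \<le> card ?D"
    using card_regular[OF x k] card_regular[OF x j] sizes by linarith+
  have CD: "?C \<subseteq> {1..n}" "?D \<subseteq> {1..n}" by (auto simp: parallel_star_def)
  obtain A B where AB: "A \<subseteq> ?C - {j, k}" "B \<subseteq> ?D - {j, k} - {}" "A \<inter> B = {}" "card A = s" "t \<le> card B"
    using obtain_rectangle[of ?C 0 ?D j "\<lambda>_. {}" k, OF C D j CD] by (metis card.empty finite.emptyI le_refl)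
  then have "A \<subseteq> {1..n} - {j, k}" "B \<subseteq> {1..n} - {j, k}" using CD by blast+
  then obtain a b where ab: "a \<in> A" "b \<in> B" "a \<noteq> b"
    "adj W (flip a x) b" "adj W (flip a (flip k x)) b"
    "adj W (flip b x) a" "adj W (flip b (flip j x)) a"
    "adj W (flip a (flip b x)) k" "adj W (flip a (flip b x)) j"
    using obtain_link[OF x j k jk, of A B] AB by (metis order_refl)
  have a: "a \<in> ?C" "a \<noteq> j" and b: "b \<in> ?D" "b \<noteq> k" using ab AB by blast+
  note ra = regularD[OF a(1)] and rb = regularD[OF b(1)]
  have "colour (flip b (flip a x)) k = sigma k"
    using ab a b ra rb x k j tau_eq_sigma[OF x k] by (subst colour_square) (auto simp: flip_commute)
  moreover have "colour (flip a (flip b x)) j = sigma j"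
    using ab a b ra rb x k j tau_eq_sigma[OF x j] by (subst colour_square) (auto simp: flip_commute)
  moreover have "colour (flip a (flip b x)) j \<noteq> colour (flip a (flip b x)) k"
    using ab ra rb x k j jk by (intro colour_inj) auto
  ultimately show False using eq by (simp add: flip_commute)
qed

section \<open>Exceptional edges at a vertex, and the translation part\<close>

definition star_exceptions :: "(nat \<Rightarrow> bit) \<Rightarrow> nat set" where
  "star_exceptions x = {i\<in>star n W x. colour x i \<noteq> sigma i}"

lemma finite_star_exceptions [simp]: "finite (star_exceptions x)"
  by (simp add: star_exceptions_def)

text \<open>\<open>tau\<close> speaks only of edges at the neighbours of \<open>x\<close>. Among
  \<open>s\<close> exceptional directions some \<open>a\<close> would be linked to a
  \<open>b\<close> outside \<open>exceptions x a\<close>; the 4-cycle through \<open>x\<close>,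
  \<open>x + a\<close>, \<open>x + b\<close> then forces the colour \<open>sigma a\<close> on the
  \<open>a\<close>-edge at \<open>x\<close>.\<close>

lemma card_star_exceptions:
  assumes x: "x \<in> configs n"
  shows "card (star_exceptions x) \<le> s"
proof (rule ccontr)
  assume "\<not> ?thesis"
  then have "s \<le> card (star_exceptions x)" by simp
  then obtain A where A: "A \<subseteq> star_exceptions x" "card A = s" "finite A"
    by (metis obtain_subset_with_card_n)
  have A1: "A \<subseteq> {1..n}" using A by (auto simp: star_exceptions_def star_def)
  obtain j where j: "j \<in> {1..n}" "j \<notin> A" using obtain_other[of A] A by auto
  obtain k where k: "k \<in> {1..n}" "k \<notin> insert j A" using obtain_other[of "insert j A"] A j by auto
  \<comment> \<open>At most \<open>2 + s + s * s\<close> directions: \<open>A\<close> has exactly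
    \<open>s\<close> elements, each with at most \<open>s\<close> exceptions.\<close>
  define E where "E = ({j, k} \<union> A) \<union> (\<Union>a\<in>A. exceptions x a)"
  have "card (\<Union>a\<in>A. exceptions x a) \<le> s * s"
    using card_UN_bounded[OF A(3) eq_imp_le[OF A(2)], of "exceptions x" s] card_exceptions[OF x] A1 by blast
  moreover have "card {j, k} \<le> 2" by (simp add: card_insert_if)
  ultimately have "card E \<le> 2 + s + s * s"
    using card_Un_le[of "{j, k} \<union> A" "\<Union>a\<in>A. exceptions x a"] card_Un_le[of "{j, k}" A] A(2)
    unfolding E_def by linarith
  then have "t \<le> card (star n W x - E)"
    using sizes card_star[OF x] A(3) by (intro card_Diff_lower[of _ "2 + s + s * s"]) (auto simp: E_def)
  moreover have "A \<subseteq> {1..n} - {j, k}" "star n W x - E \<subseteq> {1..n} - {j, k}" "A \<inter> (star n W x - E) = {}"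
    using A1 j k by (auto simp: E_def star_def)
  moreover have "j \<noteq> k" using k by auto
  ultimately obtain a b where ab: "a \<in> A" "b \<in> star n W x - E" "a \<noteq> b"
    "adj W (flip a x) b" "adj W (flip b x) a"
    using obtain_link[of x j k A "star n W x - E"] x j(1) k(1) A(2) by (metis order_refl)
  then have ab': "a \<in> {1..n}" "b \<in> {1..n}" "adj W x a" "adj W x b" "colour x a \<noteq> sigma a" "b \<notin> exceptions x a"
    using A(1) by (auto simp: star_exceptions_def star_def E_def)
  have "colour (flip b x) a = colour x a"
    using ab ab' x by (intro colour_square) auto
  moreover have "b \<in> parallel_star n W x a" using ab ab' by (simp add: parallel_star_def)
  then have "colour (flip b x) a = tau x a" using ab'(6) by (simp add: exceptions_def)
  ultimately show False using ab' tau_eq_sigma[OF x ab'(1)] by simp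
qed

text \<open>Addition is subtraction modulo 2, so this is the candidate translation vector, indexed
  by the directions of the source.\<close>

definition shift :: "(nat \<Rightarrow> bit) \<Rightarrow> nat \<Rightarrow> bit" where
  "shift x = (\<lambda>i\<in>{1..n}. p x (sigma i) + x i)"

text \<open>Coordinate \<open>sigma k\<close> of \<open>p x\<close> and coordinate \<open>k\<close>
  of \<open>x\<close> flip together and cancel in the sum; injectivity of \<open>sigma\<close>
  protects the other coordinates.\<close>

lemma shift_flip_regular:
  assumes "x \<in> configs n" "k \<in> {1..n}" "adj W x k" "colour x k = sigma k"
  shows "shift (flip k x) = shift x"
proof
  fix i
  show "shift (flip k x) i = shift x i"
  proof (cases "i \<in> {1..n}")
    case True
    then have "sigma i = sigma k \<longleftrightarrow> i = k" using sigma_inj assms(2) by (simp add: inj_on_eq_iff)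
    then show ?thesis
      using colour(2)[OF assms(1-3)] True assms(4) by (auto simp: shift_def flip_apply algebra_simps)
  next
    case False
    then show ?thesis unfolding shift_def restrict_def by (simp only: if_False)
  qed
qed

lemma shift_flip:
  assumes x: "x \<in> configs n" and j: "j \<in> {1..n}"
  shows "shift (flip j x) = shift x"
proof -
  let ?y = "flip j x"
  have y: "?y \<in> configs n" using x j by simp
  obtain k where k: "k \<in> {1..n}" "k \<noteq> j" using obtain_other[of "{j}"] by auto
  let ?C = "star n W x - star_exceptions x"
  let ?D = "star n W ?y - star_exceptions ?y"
  \<comment> \<open>The directions \<open>b\<close> that would make an inner edge of the detour
    exceptional: the \<open>b\<close>-edge at \<open>x + a\<close>, the \<open>j\<close>-edge at
    \<open>x + a + b\<close>, the \<open>a\<close>-edge at \<open>x + j + b\<close>. The two outer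
    edges are governed by \<open>?C\<close> and \<open>?D\<close>.\<close>
  define F where "F a = star_exceptions (flip a x) \<union> exceptions (flip a x) j \<union> exceptions ?y a" for a
  define E where "E A = (\<Union>a\<in>A. F a)" for A
  have C: "s + 2 \<le> card ?C"
    using sizes card_star[OF x] card_star_exceptions[OF x] by (intro card_Diff_lower[of _ s]) auto
  have D: "2 * s + 2 + s * (3 * s) + t \<le> card ?D"
    using sizes card_star[OF y] card_star_exceptions[OF y] by (intro card_Diff_lower[of _ s]) auto
  have CD: "?C \<subseteq> {1..n}" "?D \<subseteq> {1..n}" by (auto simp: star_def)
  have F: "card (F a) \<le> 3 * s" if "a \<in> {1..n}" for a
  proof -
    have "flip a x \<in> configs n" using x that by simp
    then show ?thesis
      using card_Un_le[of "star_exceptions (flip a x) \<union> exceptions (flip a x) j" "exceptions ?y a"]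
        card_Un_le[of "star_exceptions (flip a x)" "exceptions (flip a x) j"]
        card_star_exceptions[of "flip a x"] card_exceptions[of "flip a x" j] card_exceptions[OF y that] j
      unfolding F_def by linarith
  qed
  have E: "finite (E A) \<and> card (E A) \<le> s * (3 * s)" if "A \<subseteq> ?C" "card A = s" for A
  proof
    have "finite A" using that(1) by (meson finite_Diff finite_star finite_subset)
    then show "finite (E A)" by (simp add: E_def F_def)
    show "card (E A) \<le> s * (3 * s)"
      unfolding E_def using that \<open>finite A\<close> CD F by (intro card_UN_bounded) auto
  qed
  obtain A B where AB: "A \<subseteq> ?C - {j, k}" "B \<subseteq> ?D - {j, k} - E A" "A \<inter> B = {}" "card A = s" "t \<le> card B"
    using obtain_rectangle[of ?C "s * (3 * s)" ?D j E k, OF C D j CD E] by blast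
  then have "A \<subseteq> {1..n} - {j, k}" "B \<subseteq> {1..n} - {j, k}" using CD by blast+
  then obtain a b where ab: "a \<in> A" "b \<in> B" "a \<noteq> b"
    "adj W (flip a x) b" "adj W (flip b (flip j x)) a" "adj W (flip a (flip b x)) j"
    using obtain_link[OF x j k(1) k(2)[symmetric], of A B] AB by (metis order_refl)
  have a: "a \<in> {1..n}" "a \<noteq> j" "adj W x a" "colour x a = sigma a"
    using ab AB by (auto simp: star_exceptions_def star_def)
  have b: "b \<in> {1..n}" "b \<noteq> j" "adj W ?y b" "colour ?y b = sigma b" "b \<notin> F a"
    using ab AB by (auto simp: star_exceptions_def star_def E_def)
  have "colour (flip a x) b = sigma b"
    using b ab(4) by (auto simp: F_def star_exceptions_def star_def)
  then have 1: "shift (flip b (flip a x)) = shift (flip a x)"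
    using a b ab x by (intro shift_flip_regular) auto
  have "b \<in> parallel_star n W (flip a x) j"
    using b ab by (simp add: parallel_star_def flip_commute[of a b])
  then have "colour (flip b (flip a x)) j = sigma j"
    using b tau_eq_sigma[of "flip a x" j] a x j by (auto simp: F_def exceptions_def)
  then have 2: "shift (flip j (flip b (flip a x))) = shift (flip b (flip a x))"
    using a b ab x j by (intro shift_flip_regular) (auto simp: flip_commute)
  have "b \<in> parallel_star n W ?y a"
    using b ab by (simp add: parallel_star_def)
  then have "colour (flip b ?y) a = sigma a"
    using b tau_eq_sigma[OF y a(1)] by (auto simp: F_def exceptions_def)
  then have 3: "shift (flip a (flip b ?y)) = shift (flip b ?y)"
    using a b ab x j by (intro shift_flip_regular) auto
  have 4: "shift (flip b ?y) = shift ?y" "shift (flip a x) = shift x"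
    using shift_flip_regular[OF y b(1,3,4)] shift_flip_regular[OF x a(1,3,4)] .
  have "flip a (flip b ?y) = flip j (flip b (flip a x))" by (simp add: flip_commute)
  with 1 2 3 4 show ?thesis by simp
qed

lemma hypercube_automorphism:
  obtains \<sigma> d where "inj_on \<sigma> {1..n}" "\<sigma> ` {1..n} \<subseteq> {1..n}"
    "\<And>x i. x \<in> configs n \<Longrightarrow> i \<in> {1..n} \<Longrightarrow> p x (\<sigma> i) = x i + d i"
proof (rule that[of sigma "shift (\<lambda>i\<in>{1..n}. 0)"])
  fix x i assume x: "x \<in> configs n" and i: "i \<in> {1..n}"
  have "shift x = shift (\<lambda>i\<in>{1..n}. 0)"
    by (rule flip_invariant_imp_constant[where g = shift, OF shift_flip]) (use x in \<open>auto simp: configs_def\<close>)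
  moreover have "shift x i = p x (sigma i) + x i" using i by (simp add: shift_def)
  ultimately have "shift (\<lambda>i\<in>{1..n}. 0) i = p x (sigma i) + x i" by simp
  then show "p x (sigma i) = x i + shift (\<lambda>i\<in>{1..n}. 0) i" by (rule bit_eq_add_swap)
qed (use sigma_inj sigma_in in auto)

end

section \<open>From asynchronous to synchronous isomorphism\<close>

definition rigid_arcs :: "nat \<Rightarrow> nat \<Rightarrow> nat \<Rightarrow> nat \<Rightarrow> ((nat \<Rightarrow> bit) \<times> nat) set \<Rightarrow> bool" where
  "rigid_arcs n s t m W \<longleftrightarrow> linked n s t W \<and> (\<forall>x\<in>configs n. m \<le> card (star n W x)) \<and>
     (\<forall>x\<in>configs n. \<forall>k\<in>{1..n}. m \<le> card (parallel_star n W x k))"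

definition arc_set :: "nat \<Rightarrow> ((nat \<Rightarrow> bit) \<Rightarrow> (nat \<Rightarrow> bit)) \<Rightarrow> ((nat \<Rightarrow> bit) \<times> nat) set" where
  "arc_set n f = {(x, i). x \<in> configs n \<and> i \<in> {1..n} \<and> f x i \<noteq> x i}"

definition flip_arcs :: "nat \<Rightarrow> ((nat \<Rightarrow> bit) \<Rightarrow> (nat \<Rightarrow> bit)) \<Rightarrow> ((nat \<Rightarrow> bit) \<times> (nat \<Rightarrow> bit)) set" where
  "flip_arcs n f = {(x, flip i x) | x i. (x, i) \<in> arc_set n f}"

lemma async_graph_flip:
  "async_graph n f = \<lparr>verts = configs n, arcs = flip_arcs n f, tail = fst, head = snd\<rparr>"
proof -
  have "{(x, add_config n x (unit_config n i)) | x i. x \<in> configs n \<and> i \<in> {1..n} \<and> f x i \<noteq> x i} = flip_arcs n f"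
    by (auto simp: flip_arcs_def arc_set_def add_unit_config) (metis add_unit_config atLeastAtMost_iff One_nat_def)+
  then show ?thesis by (simp add: async_graph_def)
qed

lemma flip_arcs_iff:
  assumes "x \<in> configs n" "i \<in> {1..n}"
  shows "(x, flip i x) \<in> flip_arcs n f \<longleftrightarrow> f x i \<noteq> x i"
  using assms by (auto simp: flip_arcs_def arc_set_def)

text \<open>By rigidity the inverse of the isomorphism is a hypercube automorphism, sending
  direction \<open>i\<close> to \<open>\<sigma> i\<close> at every vertex. Hence the coordinates
  changed by \<open>f\<close> at \<open>x\<close> correspond to those changed by \<open>h\<close> at
  the image of \<open>x\<close>, and the same bijection is a synchronous isomorphism.\<close>

lemma sync_equiv_of_async_iso:
  assumes f: "f \<in> networks n" and h: "h \<in> networks n"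
    and iso: "digraph_iso (async_graph n h) (async_graph n f)"
    and rigid: "rigid_arcs n s t m (arc_set n f)"
    and sizes: "0 < s" "s + 2 < n" "3 * (s * s) + 4 * s + 2 * t + 3 \<le> m"
  shows "sync_equiv n h f"
proof -
  let ?V = "configs n"
  have sub: "flip_arcs n g \<subseteq> ?V \<times> ?V" for g by (auto simp: flip_arcs_def arc_set_def)
  obtain p where p: "bij_betw p ?V ?V" "map_prod p p ` flip_arcs n h = flip_arcs n f"
    using iso unfolding async_graph_flip by (auto simp: digraph_iso_pairs[OF sub sub])
  define r where "r = inv_into ?V p"
  have r: "bij_betw r ?V ?V" unfolding r_def by (rule bij_betw_inv_into[OF p(1)])
  have rp: "r (p x) = x" "p (r x) = x" if "x \<in> ?V" for x
    unfolding r_def using that p(1) by (auto simp: bij_betw_inv_into_left bij_betw_inv_into_right)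
  have pV: "p x \<in> ?V" and rV: "r x \<in> ?V" if "x \<in> ?V" for x
    using that p(1) r by (auto simp: bij_betw_def)
  have arcs: "(x, y) \<in> flip_arcs n f \<longleftrightarrow> (r x, r y) \<in> flip_arcs n h" if "x \<in> ?V" "y \<in> ?V" for x y
  proof
    assume "(x, y) \<in> flip_arcs n f"
    then obtain u v where "(u, v) \<in> flip_arcs n h" "x = p u" "y = p v" using p(2) by force
    moreover from this have "u \<in> ?V" "v \<in> ?V" using sub by auto
    ultimately show "(r x, r y) \<in> flip_arcs n h" using rp by simp
  next
    assume "(r x, r y) \<in> flip_arcs n h"
    then have "map_prod p p (r x, r y) \<in> flip_arcs n f" using p(2) by blast
    then show "(x, y) \<in> flip_arcs n f" using rp that by simp
  qed
  \<comment> \<open>Rigidity is assumed for the arcs of \<open>f\<close>, so the embedding is the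
    inverse \<open>r\<close>, which starts from the graph of \<open>f\<close>.\<close>
  interpret hypercube_embedding n s t m "arc_set n f" r
  proof
    fix x i assume x: "x \<in> ?V" and i: "i \<in> {1..n}" and "adj (arc_set n f) x i"
    then have "(x, flip i x) \<in> flip_arcs n f \<or> (flip i x, x) \<in> flip_arcs n f"
      by (auto simp: adj_def flip_arcs_def)
    then have "(r x, r (flip i x)) \<in> flip_arcs n h \<or> (r (flip i x), r x) \<in> flip_arcs n h"
      using arcs x i by simp
    then show "\<exists>a\<in>{1..n}. r (flip i x) = flip a (r x)"
      by (auto simp: flip_arcs_def arc_set_def) (metis One_nat_def atLeastAtMost_iff flip_flip)
  qed (use r rigid sizes in \<open>auto simp: bij_betw_def rigid_arcs_def\<close>)
  obtain \<sigma> d where \<sigma>: "inj_on \<sigma> {1..n}" "\<sigma> ` {1..n} \<subseteq> {1..n}"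
    and r_eq: "\<And>x i. x \<in> ?V \<Longrightarrow> i \<in> {1..n} \<Longrightarrow> r x (\<sigma> i) = x i + d i"
    using hypercube_automorphism by blast
  have surj: "\<sigma> ` {1..n} = {1..n}" using endo_inj_surj[OF _ \<sigma>(2,1)] by simp
  have \<sigma>_eqI: "x = y" if "x \<in> ?V" "y \<in> ?V" "\<And>i. i \<in> {1..n} \<Longrightarrow> x (\<sigma> i) = y (\<sigma> i)" for x y
    using that surj by (intro configs_eqI[of x n y]) (metis imageE)+
  have r_flip: "r (flip i x) = flip (\<sigma> i) (r x)" if x: "x \<in> ?V" and i: "i \<in> {1..n}" for x i
  proof (rule \<sigma>_eqI)
    fix j assume j: "j \<in> {1..n}"
    then have "\<sigma> j = \<sigma> i \<longleftrightarrow> j = i" using \<sigma>(1) i by (simp add: inj_on_eq_iff)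
    then show "r (flip i x) (\<sigma> j) = flip (\<sigma> i) (r x) (\<sigma> j)"
      using r_eq[of "flip i x" j] r_eq[of x j] x i j by (auto simp: flip_apply algebra_simps)
  next
    have "\<sigma> i \<in> {1..n}" using \<sigma>(2) i by blast
    then show "flip (\<sigma> i) (r x) \<in> ?V" using rV x by simp
    show "r (flip i x) \<in> ?V" using rV x i by simp
  qed
  have fV: "f x \<in> ?V" and hV: "h x \<in> ?V" if "x \<in> ?V" for x
    using f h that by (auto simp: networks_def)
  have conj: "h (r x) = r (f x)" if x: "x \<in> ?V" for x
  proof (rule \<sigma>_eqI)
    fix i assume i: "i \<in> {1..n}"
    have "\<sigma> i \<in> {1..n}" using \<sigma>(2) i by blast
    then have "h (r x) (\<sigma> i) \<noteq> r x (\<sigma> i) \<longleftrightarrow> f x i \<noteq> x i"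
      using arcs[of x "flip i x"] x i r_flip[OF x i] flip_arcs_iff[of x n i f]
        flip_arcs_iff[of "r x" n "\<sigma> i" h] rV[OF x] by simp
    \<comment> \<open>Both sides arise from \<open>r x (\<sigma> i)\<close> by adding 1 exactly when
      \<open>f x i \<noteq> x i\<close>.\<close>
    then show "h (r x) (\<sigma> i) = r (f x) (\<sigma> i)"
      using r_eq[OF x i] r_eq[OF fV[OF x] i] bit_neq_iff[of "f x i" "x i"]
        bit_neq_iff[of "h (r x) (\<sigma> i)" "r x (\<sigma> i)"]
      by (metis add.commute add.left_commute)
  qed (use fV hV rV x in auto)
  have sync: "map_prod p p ` {(x, h x) | x. x \<in> ?V} = {(x, f x) | x. x \<in> ?V}"
  proof (intro equalityI subsetI)
    fix z assume "z \<in> map_prod p p ` {(x, h x) | x. x \<in> ?V}"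
    then obtain x where x: "x \<in> ?V" "z = (p x, p (h x))" by auto
    then have "p (h x) = f (p x)" using conj[OF pV[OF x(1)]] rp fV pV by (metis)
    then show "z \<in> {(x, f x) | x. x \<in> ?V}" using x pV by auto
  next
    fix z assume "z \<in> {(x, f x) | x. x \<in> ?V}"
    then obtain x where x: "x \<in> ?V" "z = (x, f x)" by auto
    then have "z = map_prod p p (r x, h (r x))" using rp conj fV by simp
    then show "z \<in> map_prod p p ` {(x, h x) | x. x \<in> ?V}" using rV x by blast
  qed
  show ?thesis
    unfolding sync_equiv_def sync_graph_def
    by (subst digraph_iso_pairs) (use p(1) sync fV hV in auto)
qed

text \<open>Turns a uniform network into a uniform set of arcs, that is, one fair coin per vertex
  and direction.\<close>

lemma bij_betw_arc_set: "bij_betw (arc_set n) (networks n) (Pow (configs n \<times> {1..n}))"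
proof (rule bij_betw_byWitness[where f' = "\<lambda>W. \<lambda>x\<in>configs n. \<lambda>i\<in>{1..n}. if (x, i) \<in> W then x i + 1 else x i"])
  let ?g = "\<lambda>W. \<lambda>x\<in>configs n. \<lambda>i\<in>{1..n}. if (x, i) \<in> W then x i + 1 else x i"
  show "\<forall>f\<in>networks n. ?g (arc_set n f) = f"
  proof
    fix f assume f: "f \<in> networks n"
    show "?g (arc_set n f) = f"
    proof
      fix x
      show "?g (arc_set n f) x = f x"
      proof (cases "x \<in> configs n")
        case True
        have "(\<lambda>i\<in>{1..n}. if (x, i) \<in> arc_set n f then x i + 1 else x i) = f x"
        proof (rule configs_eqI)
          show "f x \<in> configs n" using f True by (auto simp: networks_def)
          fix i assume "i \<in> {1..n}"
          then show "(\<lambda>i\<in>{1..n}. if (x, i) \<in> arc_set n f then x i + 1 else x i) i = f x i"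
            using True bit_neq_iff[of "f x i" "x i"] by (auto simp: arc_set_def)
        qed (simp add: configs_def)
        with True show ?thesis by simp
      next
        case False
        with f show ?thesis by (auto simp: networks_def PiE_def extensional_def)
      qed
    qed
  qed
  show "\<forall>W\<in>Pow (configs n \<times> {1..n}). arc_set n (?g W) = W"
  proof
    fix W assume W: "W \<in> Pow (configs n \<times> {1..n})"
    have "?g W x i \<noteq> x i \<longleftrightarrow> (x, i) \<in> W" if "x \<in> configs n" "i \<in> {1..n}" for x i
      using that bit_cases[of "x i"] by auto
    then show "arc_set n (?g W) = W" unfolding arc_set_def using W by blast
  qed
  show "arc_set n ` networks n \<subseteq> Pow (configs n \<times> {1..n})"
    by (auto simp: arc_set_def)
  show "?g ` Pow (configs n \<times> {1..n}) \<subseteq> networks n"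
    by (simp only: networks_def configs_def restrict_PiE_iff image_subset_iff) simp
qed

lemma card_configs: "card (configs n) = 2 ^ n"
proof -
  have "(UNIV :: bit set) = {0, 1}" using bit_cases by auto
  moreover have "card {0, 1 :: bit} = 2" by simp
  ultimately have "card (UNIV :: bit set) = 2" by (simp only:)
  then show ?thesis unfolding configs_def by (simp add: card_PiE)
qed

section \<open>Counting arc sets\<close>

text \<open>Independence in counting form: the traces of \<open>W\<close> on \<open>S\<close> and
  off \<open>S\<close> vary freely.\<close>

lemma sum_Pow_split:
  fixes g h :: "'a set \<Rightarrow> real"
  assumes "finite U" "S \<subseteq> U"
  shows "(\<Sum>W\<in>Pow U. g (W \<inter> S) * h (W - S)) = (\<Sum>W\<in>Pow S. g W) * (\<Sum>W\<in>Pow (U - S). h W)"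
proof -
  have "(\<Sum>W\<in>Pow S. g W) * (\<Sum>W\<in>Pow (U - S). h W) = (\<Sum>(X, Y)\<in>Pow S \<times> Pow (U - S). g X * h Y)"
    by (simp add: sum_product sum.cartesian_product)
  also have "\<dots> = (\<Sum>W\<in>Pow U. g (W \<inter> S) * h (W - S))"
    by (rule sum.reindex_bij_witness[of _ "\<lambda>W. (W \<inter> S, W - S)" "\<lambda>(X, Y). X \<union> Y"])
      (use assms in \<open>auto intro!: arg_cong2[where f = "(*)"] arg_cong[where f = g] arg_cong[where f = h]\<close>)
  finally show ?thesis by simp
qed

text \<open>Up to normalisation by powers of 2, the mean of a product over disjoint blocks is the
  product of the means, each at most \<open>r\<close>. Blocks are split off one at a time.\<close>

lemma sum_Pow_prod_disjoint_le:
  fixes g :: "'c \<Rightarrow> 'a set \<Rightarrow> real"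
  assumes "finite C" "finite U" "\<And>c. c \<in> C \<Longrightarrow> S c \<subseteq> U" "disjoint_family_on S C" "0 \<le> r"
    and "\<And>c W. c \<in> C \<Longrightarrow> 0 \<le> g c W"
    and "\<And>c. c \<in> C \<Longrightarrow> (\<Sum>W\<in>Pow (S c). g c W) \<le> r * 2 ^ card (S c)"
  shows "(\<Sum>W\<in>Pow U. \<Prod>c\<in>C. g c (W \<inter> S c)) \<le> r ^ card C * 2 ^ card U"
  using assms
proof (induction C arbitrary: U rule: finite_induct)
  case empty
  then show ?case by (simp add: card_Pow)
next
  case (insert c C)
  have disj: "S c \<inter> S c' = {}" if "c' \<in> C" for c'
    using insert.prems(3) insert.hyps(2) that unfolding disjoint_family_on_def by (metis insert_iff)
  have "(\<Prod>c\<in>insert c C. g c (W \<inter> S c)) = g c (W \<inter> S c) * (\<Prod>c'\<in>C. g c' ((W - S c) \<inter> S c'))" for W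
  proof -
    have "(W - S c) \<inter> S c' = W \<inter> S c'" if "c' \<in> C" for c' using disj[OF that] by blast
    then show ?thesis using insert.hyps by simp
  qed
  then have "(\<Sum>W\<in>Pow U. \<Prod>c\<in>insert c C. g c (W \<inter> S c))
      = (\<Sum>W\<in>Pow (S c). g c W) * (\<Sum>W\<in>Pow (U - S c). \<Prod>c'\<in>C. g c' (W \<inter> S c'))"
    using sum_Pow_split[of U "S c" "g c" "\<lambda>W. \<Prod>c'\<in>C. g c' (W \<inter> S c')"] insert.prems(1,2) by simp
  also have "\<dots> \<le> (r * 2 ^ card (S c)) * (r ^ card C * 2 ^ card (U - S c))"
  proof (rule mult_mono)
    show "(\<Sum>W\<in>Pow (U - S c). \<Prod>c'\<in>C. g c' (W \<inter> S c')) \<le> r ^ card C * 2 ^ card (U - S c)"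
    proof (rule insert.IH)
      show "S c' \<subseteq> U - S c" if "c' \<in> C" for c' using insert.prems(2) disj that by blast
      show "disjoint_family_on S C" using insert.prems(3) by (simp add: disjoint_family_on_def)
    qed (use insert.prems in auto)
  qed (use insert.prems in \<open>auto intro!: sum_nonneg prod_nonneg\<close>)
  also have "\<dots> = r ^ card (insert c C) * 2 ^ (card (S c) + card (U - S c))"
    using insert.hyps by (simp add: power_add)
  also have "card (S c) + card (U - S c) = card U"
    using insert.prems(1,2) by (metis card_Diff_subset card_mono finite_subset insertI1 le_add_diff_inverse)
  finally show ?case .
qed

lemma card_le_sum_weights:
  fixes w :: "'a set \<Rightarrow> real"
  assumes "finite U" "\<And>W. W \<subseteq> U \<Longrightarrow> 0 \<le> w W" "\<And>W. W \<subseteq> U \<Longrightarrow> Q W \<Longrightarrow> 1 \<le> w W"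
  shows "real (card {W\<in>Pow U. Q W}) \<le> (\<Sum>W\<in>Pow U. w W)"
proof -
  have "real (card {W\<in>Pow U. Q W}) = (\<Sum>W\<in>{W\<in>Pow U. Q W}. 1)" by simp
  also have "\<dots> \<le> (\<Sum>W\<in>{W\<in>Pow U. Q W}. w W)" using assms(3) by (intro sum_mono) auto
  also have "\<dots> \<le> (\<Sum>W\<in>Pow U. w W)" using assms(1,2) by (intro sum_mono2) auto
  finally show ?thesis .
qed

section \<open>Lower tails of the degrees\<close>

definition edge_arcs :: "(nat \<Rightarrow> bit) \<Rightarrow> nat \<Rightarrow> ((nat \<Rightarrow> bit) \<times> nat) set" where
  "edge_arcs y d = {(y, d), (flip d y, d)}"

lemma adj_iff_edge_arcs: "adj W y d \<longleftrightarrow> W \<inter> edge_arcs y d \<noteq> {}"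
  by (auto simp: adj_def edge_arcs_def)

text \<open>Exponential Markov inequality: each present edge contributes a factor 1/4, so the mean weight
  per edge is \<open>1/4 + 3/4 \<cdot> 1/4 = 7/16\<close>. It is essential that this is below 1/2.\<close>

lemma few_adj_count:
  assumes "finite C" "finite U" "\<And>c. c \<in> C \<Longrightarrow> edge_arcs (y c) (d c) \<subseteq> U"
    and "disjoint_family_on (\<lambda>c. edge_arcs (y c) (d c)) C"
  shows "real (card {W\<in>Pow U. card {c\<in>C. adj W (y c) (d c)} < m}) \<le> 4 ^ m * (7 / 16) ^ card C * 2 ^ card U"
proof -
  define g :: "((nat \<Rightarrow> bit) \<times> nat) set \<Rightarrow> real" where "g W = (if W = {} then 1 else 1 / 4)" for W
  let ?S = "\<lambda>c. edge_arcs (y c) (d c)"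
  have prod: "(\<Prod>c\<in>C. g (W \<inter> ?S c)) = (1 / 4) ^ card {c\<in>C. adj W (y c) (d c)}" for W
  proof -
    have "(\<Prod>c\<in>C. g (W \<inter> ?S c)) = (\<Prod>c\<in>C. if adj W (y c) (d c) then 1 / 4 else 1)"
      by (intro prod.cong) (auto simp: g_def adj_iff_edge_arcs)
    also have "\<dots> = (1 / 4) ^ card {c\<in>C. adj W (y c) (d c)}"
      using assms(1) by (simp add: prod.If_cases Int_def)
    finally show ?thesis .
  qed
  have "real (card {W\<in>Pow U. card {c\<in>C. adj W (y c) (d c)} < m})
      \<le> (\<Sum>W\<in>Pow U. 4 ^ m * (\<Prod>c\<in>C. g (W \<inter> ?S c)))"
  proof (rule card_le_sum_weights[OF assms(2)])
    fix W assume "card {c\<in>C. adj W (y c) (d c)} < m"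
    then have "(1 / 4 :: real) ^ m \<le> (1 / 4) ^ card {c\<in>C. adj W (y c) (d c)}"
      by (intro power_decreasing) auto
    then have "4 ^ m * (1 / 4 :: real) ^ m \<le> 4 ^ m * (1 / 4) ^ card {c\<in>C. adj W (y c) (d c)}"
      by simp
    then show "1 \<le> 4 ^ m * (\<Prod>c\<in>C. g (W \<inter> ?S c))"
      unfolding prod by (simp add: power_divide)
  qed (simp add: prod)
  also have "\<dots> = 4 ^ m * (\<Sum>W\<in>Pow U. \<Prod>c\<in>C. g (W \<inter> ?S c))" by (simp add: sum_distrib_left)
  also have "\<dots> \<le> 4 ^ m * ((7 / 16) ^ card C * 2 ^ card U)"
  proof (rule mult_left_mono[OF sum_Pow_prod_disjoint_le[OF assms]])
    fix c
    have two: "Pow (?S c) = {{}, {(y c, d c)}, {(flip (d c) (y c), d c)}, ?S c}" "card (?S c) = 2"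
      by (auto simp: edge_arcs_def Pow_insert)
    show "(\<Sum>W\<in>Pow (?S c). g W) \<le> 7 / 16 * 2 ^ card (?S c)"
      unfolding two by (simp add: g_def edge_arcs_def)
  qed (auto simp: g_def)
  finally show ?thesis by (simp add: mult.assoc)
qed

lemma few_star_count:
  assumes x: "x \<in> configs n"
  shows "real (card {W\<in>Pow (configs n \<times> {1..n}). card (star n W x) < m})
    \<le> 4 ^ m * (7 / 16) ^ n * 2 ^ card (configs n \<times> {1..n})"
proof -
  have sub: "edge_arcs x i \<subseteq> configs n \<times> {1..n}" if "i \<in> {1..n}" for i
    using that x by (auto simp: edge_arcs_def)
  have "disjoint_family_on (edge_arcs x) {1..n}"
    by (auto simp: disjoint_family_on_def edge_arcs_def)
  then have "real (card {W\<in>Pow (configs n \<times> {1..n}). card {i\<in>{1..n}. adj W x i} < m})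
    \<le> 4 ^ m * (7 / 16) ^ card {1..n} * 2 ^ card (configs n \<times> {1..n})"
    using finite_configs sub by (intro few_adj_count) auto
  then show ?thesis unfolding star_def by simp
qed

lemma few_parallel_star_count:
  assumes x: "x \<in> configs n" and k: "k \<in> {1..n}"
  shows "real (card {W\<in>Pow (configs n \<times> {1..n}). card (parallel_star n W x k) < m})
    \<le> 4 ^ m * (7 / 16) ^ (n - 1) * 2 ^ card (configs n \<times> {1..n})"
proof -
  have "disjoint_family_on (\<lambda>i. edge_arcs (flip i x) k) ({1..n} - {k})"
    unfolding disjoint_family_on_def
  proof (intro ballI impI)
    fix i j assume ij: "i \<in> {1..n} - {k}" "j \<in> {1..n} - {k}" "i \<noteq> j"
    \<comment> \<open>Coordinate \<open>i\<close> separates the two edges: it is flipped at both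
      ends of the one over \<open>i\<close> and unchanged at both ends of the one over
      \<open>j\<close>.\<close>
    have "z i = x i + 1" if "(z, e) \<in> edge_arcs (flip i x) k" for z e
      using that ij by (auto simp: edge_arcs_def flip_apply)
    moreover have "z i = x i" if "(z, e) \<in> edge_arcs (flip j x) k" for z e
      using that ij by (auto simp: edge_arcs_def flip_apply)
    ultimately show "edge_arcs (flip i x) k \<inter> edge_arcs (flip j x) k = {}"
      by (metis bit_add_one_neq(1) disjoint_iff surj_pair)
  qed
  then have "real (card {W\<in>Pow (configs n \<times> {1..n}). card {i\<in>{1..n} - {k}. adj W (flip i x) k} < m})
    \<le> 4 ^ m * (7 / 16) ^ card ({1..n} - {k}) * 2 ^ card (configs n \<times> {1..n})"
    using finite_configs x k by (intro few_adj_count) (auto simp: edge_arcs_def)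
  moreover have "card ({1..n} - {k}) = n - 1" using k by simp
  ultimately show ?thesis unfolding parallel_star_def by simp
qed

text \<open>Any single arc of a link reveals \<open>{a, b}\<close> through its source and its
  direction. Hence links of different pairs use disjoint arcs and are independent.\<close>

lemma link_arcs_determine:
  assumes "(z, e) \<in> link_arcs x j k a b" "a \<notin> {j, k}" "b \<notin> {j, k}" "a \<noteq> b"
  shows "insert e {i. z i \<noteq> x i} - {j, k} = {a, b}"
proof -
  have "flip c y i = x i \<longleftrightarrow> (y i = x i) \<noteq> (i = c)" for c y i
    using bit_neq_iff[of "y i" "x i"] bit_neq_iff[of "x i" "y i"] by (cases "i = c") auto
  then show ?thesis
    using assms by (auto simp: link_arcs_def simp del: flip_same flip_other)
qed

text \<open>At least \<open>s * t\<close> independent trials; each fails with probability at most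
  \<open>1 - 1 / 2 ^ 10 = 1023 / 1024\<close>, since a link has at most ten arcs.\<close>

lemma unlinked_count:
  assumes x: "x \<in> configs n" and jk: "j \<in> {1..n}" "k \<in> {1..n}" "j \<noteq> k"
    and A: "A \<subseteq> {1..n} - {j, k}" and B: "B \<subseteq> {1..n} - {j, k}" and AB: "A \<inter> B = {}"
    and st: "s \<le> card A" "t \<le> card B"
  shows "real (card {W\<in>Pow (configs n \<times> {1..n}). \<not> (\<exists>a\<in>A. \<exists>b\<in>B. link_arcs x j k a b \<subseteq> W)})
    \<le> (1023 / 1024) ^ (s * t) * 2 ^ card (configs n \<times> {1..n})"
proof -
  let ?U = "configs n \<times> {1..n}"
  define S where "S = (\<lambda>(a, b). link_arcs x j k a b)"
  define g :: "nat \<times> nat \<Rightarrow> ((nat \<Rightarrow> bit) \<times> nat) set \<Rightarrow> real" where "g c W = (if W = S c then 0 else 1)" for c W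
  have fin: "finite ?U" "finite A" "finite B"
    using finite_configs finite_subset[OF A] finite_subset[OF B] by auto
  have sub: "S c \<subseteq> ?U" if c: "c \<in> A \<times> B" for c
  proof -
    obtain a b where "c = (a, b)" "a \<in> {1..n}" "b \<in> {1..n}" using c A B by blast
    then show ?thesis using x jk by (simp add: S_def link_arcs_def)
  qed
  have disj: "disjoint_family_on S (A \<times> B)"
    unfolding disjoint_family_on_def
  proof (intro ballI impI)
    fix c c' assume c: "c \<in> A \<times> B" "c' \<in> A \<times> B" "c \<noteq> c'"
    obtain a b a' b' where ab: "c = (a, b)" "c' = (a', b')" by (metis surj_pair)
    show "S c \<inter> S c' = {}"
    proof (rule ccontr)
      assume "S c \<inter> S c' \<noteq> {}"
      then obtain z e where ze: "(z, e) \<in> link_arcs x j k a b" "(z, e) \<in> link_arcs x j k a' b'"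
        unfolding S_def ab by auto
      have na: "a \<notin> {j, k}" "b \<notin> {j, k}" "a \<noteq> b" "a' \<notin> {j, k}" "b' \<notin> {j, k}" "a' \<noteq> b'"
        using c A B AB unfolding ab by auto
      have "{a, b} = {a', b'}"
        using link_arcs_determine[OF ze(1) na(1-3)] link_arcs_determine[OF ze(2) na(4-6)] by (rule trans[OF sym])
      \<comment> \<open>As \<open>A\<close> and \<open>B\<close> are disjoint, the unordered pair
        fixes the ordered one.\<close>
      then show False using c AB unfolding ab by (auto simp: doubleton_eq_iff)
    qed
  qed
  have "real (card {W\<in>Pow ?U. \<not> (\<exists>a\<in>A. \<exists>b\<in>B. link_arcs x j k a b \<subseteq> W)})
      \<le> (\<Sum>W\<in>Pow ?U. \<Prod>c\<in>A \<times> B. g c (W \<inter> S c))"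
  proof (rule card_le_sum_weights[OF fin(1)])
    fix W assume "\<not> (\<exists>a\<in>A. \<exists>b\<in>B. link_arcs x j k a b \<subseteq> W)"
    then have "g c (W \<inter> S c) = 1" if "c \<in> A \<times> B" for c
      using that by (auto simp: g_def S_def)
    then show "1 \<le> (\<Prod>c\<in>A \<times> B. g c (W \<inter> S c))" by simp
  qed (auto simp: g_def intro!: prod_nonneg)
  also have "\<dots> \<le> (1023 / 1024) ^ card (A \<times> B) * 2 ^ card ?U"
  proof (rule sum_Pow_prod_disjoint_le[OF _ fin(1) sub disj])
    fix c assume "c \<in> A \<times> B"
    have finS: "finite (S c)" using \<open>c \<in> A \<times> B\<close> sub fin(1) finite_subset by blast
    have "card (S c) \<le> 10"
      unfolding S_def link_arcs_def by (auto split: prod.split intro!: order_trans[OF card_insert_le_m1])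
    then have "(2::real) ^ card (S c) \<le> 2 ^ 10" by (intro power_increasing) auto
    moreover have "(\<Sum>W\<in>Pow (S c). g c W) = (\<Sum>W\<in>Pow (S c) - {S c}. 1)"
      using finS by (intro sum.mono_neutral_cong_right) (auto simp: g_def)
    then have "(\<Sum>W\<in>Pow (S c). g c W) = 2 ^ card (S c) - 1"
      using finS by (simp add: card_Diff_subset card_Pow of_nat_diff)
    ultimately show "(\<Sum>W\<in>Pow (S c). g c W) \<le> 1023 / 1024 * 2 ^ card (S c)" by simp
  qed (use fin in \<open>auto simp: g_def\<close>)
  also have "\<dots> \<le> (1023 / 1024) ^ (s * t) * 2 ^ card ?U"
    using st by (intro mult_right_mono power_decreasing) (auto simp: card_cartesian_product mult_le_mono)
  finally show ?thesis .
qed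

section \<open>Union bounds over all failures\<close>

lemma card_UN_real_le:
  assumes "finite I" "real (card I) \<le> c" "0 \<le> b" "\<And>i. i \<in> I \<Longrightarrow> real (card (F i)) \<le> b"
  shows "real (card (\<Union>i\<in>I. F i)) \<le> c * b"
proof -
  have "real (card (\<Union>i\<in>I. F i)) \<le> real (\<Sum>i\<in>I. card (F i))"
    using card_UN_le[OF assms(1), of F] by (simp only: of_nat_le_iff)
  also have "\<dots> = (\<Sum>i\<in>I. real (card (F i)))" by simp
  also have "\<dots> \<le> real (card I) * b" using sum_bounded_above[of I _ b] assms(4) by simp
  also have "\<dots> \<le> c * b" using assms(2,3) by (rule mult_right_mono)
  finally show ?thesis .
qed

text \<open>The union runs over \<open>2 ^ n\<close> vertices, at most \<open>n ^ 2\<close> pairs of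
  directions and at most \<open>4 ^ n\<close> pairs of sets.\<close>

lemma not_linked_count:
  "real (card {W\<in>Pow (configs n \<times> {1..n}). \<not> linked n s t W})
    \<le> real n ^ 2 * 8 ^ n * ((1023 / 1024) ^ (s * t) * 2 ^ card (configs n \<times> {1..n}))"
proof -
  let ?U = "configs n \<times> {1..n}"
  let ?K = "configs n \<times> {1..n} \<times> {1..n} \<times> Pow {1..n} \<times> Pow {1..n}"
  define J where "J = {(x, j, k, A, B). x \<in> configs n \<and> j \<in> {1..n} \<and> k \<in> {1..n} \<and>
    A \<subseteq> {1..n} - {j, k} \<and> B \<subseteq> {1..n} - {j, k} \<and> j \<noteq> k \<and> A \<inter> B = {} \<and> s \<le> card A \<and> t \<le> card B}"
  define F where "F = (\<lambda>(x, j, k, A, B). {W\<in>Pow ?U. \<not> (\<exists>a\<in>A. \<exists>b\<in>B. link_arcs x j k a b \<subseteq> W)})"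
  have fin: "finite ?U" "finite ?K" using finite_configs by auto
  have J: "J \<subseteq> ?K" by (auto simp: J_def)
  have "card J \<le> card ?K" by (rule card_mono[OF fin(2) J])
  also have "\<dots> = n ^ 2 * (2 ^ n * 2 ^ n * 2 ^ n)"
    by (simp add: card_cartesian_product card_Pow card_configs power2_eq_square)
  also have "(2::nat) ^ n * 2 ^ n * 2 ^ n = 8 ^ n" by (simp flip: power_mult_distrib)
  finally have "real (card J) \<le> real (n ^ 2 * 8 ^ n)" by (simp only: of_nat_le_iff)
  then have cJ: "real (card J) \<le> real n ^ 2 * 8 ^ n" by simp
  have "{W\<in>Pow ?U. \<not> linked n s t W} \<subseteq> (\<Union>c\<in>J. F c)"
  proof
    fix W assume "W \<in> {W\<in>Pow ?U. \<not> linked n s t W}"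
    then obtain x j k A B where "(x, j, k, A, B) \<in> J" "W \<in> F (x, j, k, A, B)"
      unfolding linked_def J_def F_def by auto
    then show "W \<in> (\<Union>c\<in>J. F c)" by blast
  qed
  then have "card {W\<in>Pow ?U. \<not> linked n s t W} \<le> card (\<Union>c\<in>J. F c)"
    using fin finite_subset[OF J] by (intro card_mono) (auto simp: F_def)
  moreover have "real (card (\<Union>c\<in>J. F c)) \<le> real n ^ 2 * 8 ^ n * ((1023 / 1024) ^ (s * t) * 2 ^ card ?U)"
  proof (rule card_UN_real_le[OF _ cJ])
    fix c assume "c \<in> J"
    then show "real (card (F c)) \<le> (1023 / 1024) ^ (s * t) * 2 ^ card ?U"
      unfolding J_def F_def by (auto simp only: mem_Collect_eq case_prod_conv split_paired_all intro!: unlinked_count)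
  qed (use fin J finite_subset in auto)
  ultimately show ?thesis by linarith
qed

lemma not_rigid_count:
  "real (card {W\<in>Pow (configs n \<times> {1..n}). \<not> rigid_arcs n s t m W})
    \<le> (real n ^ 2 * 8 ^ n * (1023 / 1024) ^ (s * t) + 2 ^ n * (4 ^ m * (7 / 16) ^ n)
        + 2 ^ n * real n * (4 ^ m * (7 / 16) ^ (n - 1))) * 2 ^ card (configs n \<times> {1..n})"
proof -
  let ?U = "configs n \<times> {1..n}"
  define X where "X = {W\<in>Pow ?U. \<not> linked n s t W}"
  define Y where "Y = (\<Union>x\<in>configs n. {W\<in>Pow ?U. card (star n W x) < m})"
  define Z where "Z = (\<Union>c\<in>?U. {W\<in>Pow ?U. card (parallel_star n W (fst c) (snd c)) < m})"
  have fin: "finite ?U" using finite_configs by auto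
  have XYZ: "{W\<in>Pow ?U. \<not> rigid_arcs n s t m W} \<subseteq> (X \<union> Y) \<union> Z"
    by (auto simp: rigid_arcs_def X_def Y_def Z_def not_le)
  have "finite ((X \<union> Y) \<union> Z)" using fin finite_configs by (auto simp: X_def Y_def Z_def)
  then have "card {W\<in>Pow ?U. \<not> rigid_arcs n s t m W} \<le> card ((X \<union> Y) \<union> Z)"
    using XYZ by (rule card_mono)
  also have "\<dots> \<le> card X + card Y + card Z"
    using card_Un_le[of "X \<union> Y" Z] card_Un_le[of X Y] by linarith
  finally have "real (card {W\<in>Pow ?U. \<not> rigid_arcs n s t m W}) \<le> real (card X) + real (card Y) + real (card Z)"
    by linarith
  moreover have "real (card X) \<le> real n ^ 2 * 8 ^ n * ((1023 / 1024) ^ (s * t) * 2 ^ card ?U)"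
    unfolding X_def by (rule not_linked_count)
  moreover have "real (card Y) \<le> 2 ^ n * (4 ^ m * (7 / 16) ^ n * 2 ^ card ?U)"
    unfolding Y_def
    by (intro card_UN_real_le few_star_count) (auto simp: finite_configs card_configs)
  moreover have "real (card Z) \<le> 2 ^ n * real n * (4 ^ m * (7 / 16) ^ (n - 1) * 2 ^ card ?U)"
    unfolding Z_def
    by (intro card_UN_real_le few_parallel_star_count) (auto simp: finite_configs card_configs card_cartesian_product)
  ultimately show ?thesis by (simp add: algebra_simps)
qed

text \<open>Every failing network has a non-rigid arc set, and \<open>arc_set\<close> carries the
  count of networks to that of arc sets; the factor 2 to the number of possible arcs is the number
  of networks and cancels.\<close>

lemma networks_failure_bound:
  assumes sizes: "0 < s" "s + 2 < n" "3 * (s * s) + 4 * s + 2 * t + 3 \<le> m"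
  shows "1 - measure_pmf.prob (pmf_of_set (networks n))
            {f. \<forall>h\<in>networks n. digraph_iso (async_graph n h) (async_graph n f) \<longrightarrow> sync_equiv n h f}
    \<le> real n ^ 2 * 8 ^ n * (1023 / 1024) ^ (s * t) + 2 ^ n * (4 ^ m * (7 / 16) ^ n)
        + 2 ^ n * real n * (4 ^ m * (7 / 16) ^ (n - 1))" (is "1 - measure_pmf.prob ?P ?E \<le> ?b")
proof -
  let ?N = "networks n" and ?U = "configs n \<times> {1..n}"
  have cardN: "card ?N = 2 ^ card ?U"
    using bij_betw_same_card[OF bij_betw_arc_set, of n] finite_configs by (simp add: card_Pow)
  let ?B = "{f\<in>?N. \<not> rigid_arcs n s t m (arc_set n f)}"
  have "1 - measure_pmf.prob ?P ?E = measure_pmf.prob ?P (- ?E)"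
    using measure_pmf.prob_compl[of ?E ?P] by (simp add: Compl_eq_Diff_UNIV)
  also have "\<dots> = card (?N \<inter> - ?E) / card ?N"
    by (rule measure_pmf_of_set[OF networks_nonempty finite_networks])
  also have "\<dots> \<le> card ?B / card ?N"
  proof -
    have "?N \<inter> - ?E \<subseteq> ?B" using sync_equiv_of_async_iso[OF _ _ _ _ sizes] by blast
    then have "card (?N \<inter> - ?E) \<le> card ?B" by (intro card_mono) (auto simp: finite_networks)
    then show ?thesis by (intro divide_right_mono) auto
  qed
  also have "card ?B = card {W\<in>Pow ?U. \<not> rigid_arcs n s t m W}"
  proof (rule bij_betw_same_card[of "arc_set n"])
    have "arc_set n ` ?B = {W\<in>Pow ?U. \<not> rigid_arcs n s t m W}"
      unfolding bij_betw_imp_surj_on[OF bij_betw_arc_set, of n, symmetric] by auto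
    then show "bij_betw (arc_set n) ?B {W\<in>Pow ?U. \<not> rigid_arcs n s t m W}"
      using bij_betw_imp_inj_on[OF bij_betw_arc_set, of n] by (auto simp: bij_betw_def inj_on_def)
  qed
  also have "real (card {W\<in>Pow ?U. \<not> rigid_arcs n s t m W}) / card ?N \<le> ?b"
    using not_rigid_count[of n s t m] unfolding cardN by (simp add: divide_le_eq)
  finally show ?thesis .
qed

section \<open>Numerical estimates\<close>

lemma power_le_half:
  assumes "0 < N"
  shows "(real N / (real N + 1)) ^ N \<le> 1 / 2"
proof -
  have "2 \<le> (1 + 1 / real N) ^ N"
    using Bernoulli_inequality[of "1 / real N" N] order_trans[of "-1" 0 "1 / real N"] assms by simp
  moreover have "1 + 1 / real N = inverse (real N / (real N + 1))"
    using assms by (simp add: field_simps)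
  ultimately have "2 \<le> inverse ((real N / (real N + 1)) ^ N)" by (simp only: power_inverse)
  then have "inverse (inverse ((real N / (real N + 1)) ^ N)) \<le> inverse 2"
    by (intro le_imp_inverse_le) auto
  then show ?thesis by simp
qed

text \<open>The constant \<open>s\<close> makes \<open>(1023/1024)\<^bsup>s t\<^esup>\<close> at most \<open>16\<^bsup>-n\<^esup>\<close>, which beats the
  \<open>8\<^sup>n\<close> choices of a vertex and two sets of directions.\<close>

lemma failure_bound_simplified:
  fixes n :: nat
  assumes n: "10 ^ 16 \<le> n"
  defines "s \<equiv> 2 * 10 ^ 6" and "t \<equiv> n div 400" and "m \<equiv> n div 100"
  shows "real n ^ 2 * 8 ^ n * (1023 / 1024) ^ (s * t) + 2 ^ n * (4 ^ m * (7 / 16) ^ n)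
        + 2 ^ n * real n * (4 ^ m * (7 / 16) ^ (n - 1))
     \<le> real n ^ 2 * (1 / 2) ^ n + 3 * (1 + real n) * (9 / 10) ^ n"
proof -
  \<comment> \<open>\<open>s * t\<close> is about \<open>5000 * n\<close>, which leaves room for
    rounding; \<open>4092 = 4 * 1023\<close> yields four halvings per unit of
    \<open>n\<close>.\<close>
  have "4092 * n \<le> s * t" using n unfolding s_def t_def by simp
  then have "(1023 / 1024 :: real) ^ (s * t) \<le> (1023 / 1024) ^ (4092 * n)"
    by (intro power_decreasing) auto
  also have "\<dots> = (((1023 / 1024) ^ 1023) ^ 4) ^ n" by (simp flip: power_mult)
  also have "\<dots> \<le> ((1 / 2) ^ 4) ^ n"
    using power_le_half[of 1023] by (intro power_mono) simp_all
  also have "\<dots> = (1 / 16) ^ n" by (simp add: power_divide)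
  finally have "real n ^ 2 * 8 ^ n * (1023 / 1024) ^ (s * t) \<le> real n ^ 2 * 8 ^ n * (1 / 16) ^ n"
    by (intro mult_left_mono) auto
  also have "\<dots> = real n ^ 2 * (1 / 2) ^ n" by (simp add: mult.assoc flip: power_mult_distrib)
  finally have 1: "real n ^ 2 * 8 ^ n * (1023 / 1024) ^ (s * t) \<le> real n ^ 2 * (1 / 2) ^ n" .
  \<comment> \<open>As \<open>4 \<le> (51 / 50) ^ 100\<close>, the base becomes
    \<open>2 * 51 / 50 * 7 / 16 = 357 / 400\<close>, below \<open>9 / 10\<close>.\<close>
  have "(4::real) ^ m \<le> ((51 / 50) ^ 100) ^ m"
    by (rule power_mono) (simp_all add: power_divide)
  also have "\<dots> = (51 / 50) ^ (100 * m)" by (simp add: power_mult)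
  also have "\<dots> \<le> (51 / 50) ^ n" by (rule power_increasing) (auto simp: m_def)
  finally have "2 ^ n * (4 ^ m * (7 / 16) ^ n) \<le> 2 ^ n * ((51 / 50) ^ n * (7 / 16 :: real) ^ n)"
    by (intro mult_left_mono mult_right_mono) auto
  also have "\<dots> = (357 / 400) ^ n" by (simp flip: power_mult_distrib)
  also have "\<dots> \<le> (9 / 10) ^ n" by (rule power_mono) auto
  finally have 2: "2 ^ n * (4 ^ m * (7 / 16) ^ n) \<le> (9 / 10 :: real) ^ n" .
  \<comment> \<open>Passing from exponent \<open>n - 1\<close> to \<open>n\<close> costs the factor
    \<open>16 / 7\<close>, at most 3.\<close>
  have "n = Suc (n - 1)" using n by simp
  then have "(7 / 16 :: real) ^ n = 7 / 16 * (7 / 16) ^ (n - 1)" by (metis power_Suc)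
  then have "(7 / 16 :: real) ^ (n - 1) = 16 / 7 * (7 / 16) ^ n" by simp
  then have "2 ^ n * real n * (4 ^ m * (7 / 16) ^ (n - 1)) = (16 / 7 * real n) * (2 ^ n * (4 ^ m * (7 / 16) ^ n))"
    by simp
  also have "\<dots> \<le> (3 * real n) * (9 / 10) ^ n"
    using 2 by (intro mult_mono) auto
  finally have 3: "2 ^ n * real n * (4 ^ m * (7 / 16) ^ (n - 1)) \<le> 3 * real n * (9 / 10) ^ n" .
  have "(0::real) \<le> (9 / 10) ^ n" by simp
  moreover have "3 * (1 + real n) * (9 / 10) ^ n = 3 * (9 / 10) ^ n + 3 * real n * (9 / 10) ^ n"
    by (simp only: distrib_left distrib_right mult_1_right)
  ultimately show ?thesis using 1 2 3 by linarith
qed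

theorem theorem1:
  shows "(\<lambda>n::nat. measure_pmf.prob (pmf_of_set (networks n))
            {f. \<forall>h\<in>networks n.
                  digraph_iso (async_graph n h) (async_graph n f) \<longrightarrow> sync_equiv n h f})
         \<longlonglongrightarrow> 1" (is "?p \<longlonglongrightarrow> 1")
proof -
  let ?b = "\<lambda>n. real n ^ 2 * (1 / 2) ^ n + 3 * (1 + real n) * (9 / 10) ^ n"
  have "(\<lambda>n. real n ^ 2 * (1 / 2) ^ n) \<longlonglongrightarrow> 0" by real_asymp
  moreover have "(\<lambda>n. 3 * (1 + real n) * (9 / 10) ^ n) \<longlonglongrightarrow> 0" by real_asymp
  ultimately have "?b \<longlonglongrightarrow> 0" by (rule tendsto_add_zero)
  then have lower: "(\<lambda>n. 1 - ?b n) \<longlonglongrightarrow> 1" using tendsto_diff[OF tendsto_const[of 1], of ?b 0] by simp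
  have "1 - ?b n \<le> ?p n" if n: "10 ^ 16 \<le> n" for n
  proof -
    \<comment> \<open>The linear terms leave about \<open>n / 200\<close>, so about
      \<open>5 * 10 ^ 13\<close> or more, against about \<open>1.2 * 10 ^ 13\<close> from the terms
      in \<open>s\<close>; this is why \<open>n\<close> starts at \<open>10 ^ 16\<close>.\<close>
    have "3 * (2 * 10 ^ 6 * (2 * 10 ^ 6)) + 4 * (2 * 10 ^ 6) + 2 * (n div 400) + 3 \<le> n div 100"
      using n by simp
    then have "1 - ?p n \<le> ?b n"
      using networks_failure_bound[of "2 * 10 ^ 6" n "n div 400" "n div 100"]
        failure_bound_simplified[OF n] n by simp
    then show ?thesis by simp
  qed
  then have "\<forall>\<^sub>F n in sequentially. 1 - ?b n \<le> ?p n"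
    by (rule eventually_sequentiallyI)
  then show ?thesis
    by (rule tendsto_sandwich[OF _ _ lower tendsto_const]) simp
qed

end
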